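(* Let $(e^{-tA})_{t\ge 0}$ be a bounded analytic $C_0$-semigroup on a Banach space $X$, with generator $-A$. Then there exists $C>0$ such that for every $\alpha\in[0,1]$, all $t>0$, all $n\in\mathbb N$ and all $x\in\operatorname{dom}(A^\alpha)$: a) (Yosida's approximation) $$\|e^{-tA}x-e^{-ntA(n+A)^{-1}}x\|\le C\,(nt^{1-\alpha})^{-1}\|A^\alpha x\|;$$ b) (Dunford-Segal approximation) $$\|e^{-tA}x-e^{-nt(1-e^{-A/n})}x\|\le C\,(nt^{1-\alpha})^{-1}\|A^\alpha x\|;$$ c) (Euler's approximation) $$\left\|e^{-tA}x-\left(1+\tfrac tn A\right)^{-n}x\right\|\le C\,(nt^{-\alpha})^{-1}\|A^\alpha x\|.$$
   Context: $X$ is a complex Banach space. A $C_0$-semigroup is bounded analytic if, for some $\theta\in(0,\pi/2]$, it has an analytic extension to the sector $\{\lambda:|\arg\lambda|<\theta\}$ that is bounded on $\{\lambda:|\arg\lambda|<\theta'\}$ for every $\theta'\in(0,\theta)$; equivalently, $\sup_{t\ge0}\|e^{-tA}\|<\infty$ and $\sup_{t>0}\|tAe^{-tA}\|<\infty$. $A^\alpha$ is the usual fractional power of the (sectorial) operator $A$, with $A^0=I$. The operators $A(n+A)^{-1}$ and $e^{-A/n}$ (the semigroup at time $1/n$) are bounded, and the exponentials in a) and b) are exponentials of bounded operators. *)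

theory Defs
  imports "HOL-Analysis.Analysis"
begin

section \<open>Complex Banach spaces\<close>

class scaleC = scaleR +
  fixes scaleC :: "complex \<Rightarrow> 'a \<Rightarrow> 'a" (infixr \<open>*\<^sub>C\<close> 75)
  assumes scaleR_scaleC: "scaleR r x = scaleC (complex_of_real r) x"

class complex_normed_vector = real_normed_vector + scaleC +
  assumes scaleC_add_right: "a *\<^sub>C (x + y) = a *\<^sub>C x + a *\<^sub>C y"
    and scaleC_add_left: "(a + b) *\<^sub>C x = a *\<^sub>C x + b *\<^sub>C x"
    and scaleC_scaleC: "a *\<^sub>C (b *\<^sub>C x) = (a * b) *\<^sub>C x"
    and scaleC_one: "1 *\<^sub>C x = x"
    and norm_scaleC: "norm (a *\<^sub>C x) = cmod a * norm x"

class complex_banach = complex_normed_vector + banach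

text \<open>
  Bounded operators on the complex space are bounded real-linear maps that satisfy the following
  predicate; the real and the complex operator norm are the same number.
\<close>

definition clinear_blinfun :: "('a::complex_banach \<Rightarrow>\<^sub>L 'a) \<Rightarrow> bool"
  where "clinear_blinfun B \<longleftrightarrow> (\<forall>c x. blinfun_apply B (c *\<^sub>C x) = c *\<^sub>C blinfun_apply B x)"

definition blinfun_power :: "('a::complex_banach \<Rightarrow>\<^sub>L 'a) \<Rightarrow> nat \<Rightarrow> ('a \<Rightarrow>\<^sub>L 'a)"
  where "blinfun_power B k = ((\<lambda>D. B o\<^sub>L D) ^^ k) id_blinfun"

text \<open>
  The library class of \<^const>\<open>exp\<close> does not contain the bounded operators
  (it requires norm 1 for the unit, which fails on the zero space). The series is taken in operator norm.
\<close>

definition blinfun_exp :: "('a::complex_banach \<Rightarrow>\<^sub>L 'a) \<Rightarrow> ('a \<Rightarrow>\<^sub>L 'a)"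
  where "blinfun_exp B = (\<Sum>k. (1 / fact k) *\<^sub>R blinfun_power B k)"


section \<open>Unbounded operators as graphs\<close>

text \<open>
  An operator \<open>A\<close> is its graph: \<open>(x, y) \<in> A\<close> means that \<open>x\<close> is in the domain and \<open>A x = y\<close>.
  The inverse is \<open>A\<inverse>\<close> and the product \<open>B A\<close> (first \<open>A\<close>, then \<open>B\<close>) is \<open>A O B\<close>.
\<close>

type_synonym 'a operator = "('a \<times> 'a) set"

definition op_graph :: "('a::complex_banach \<Rightarrow>\<^sub>L 'a) \<Rightarrow> 'a operator"
  where "op_graph B = {(x, blinfun_apply B x) | x. True}"

text \<open>The bounded everywhere defined operator with graph \<open>G\<close>; unspecified if there is none.\<close>

definition bounded_op :: "'a::complex_banach operator \<Rightarrow> ('a \<Rightarrow>\<^sub>L 'a)"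
  where "bounded_op G = (THE B. op_graph B = G)"

text \<open>The operator \<open>a I + b A\<close> with domain that of \<open>A\<close>.\<close>

definition op_affine :: "real \<Rightarrow> real \<Rightarrow> 'a::complex_banach operator \<Rightarrow> 'a operator"
  where "op_affine a b A = {(x, a *\<^sub>R x + b *\<^sub>R y) | x y. (x, y) \<in> A}"


section \<open>Bounded analytic semigroups\<close>

text \<open>Only the values at \<open>t \<ge> 0\<close> of a semigroup \<open>T\<close> are relevant.\<close>

definition C0_semigroup :: "(real \<Rightarrow> ('a::complex_banach \<Rightarrow>\<^sub>L 'a)) \<Rightarrow> bool"
  where "C0_semigroup T \<longleftrightarrow>
    (\<forall>t\<ge>0. clinear_blinfun (T t)) \<and>
    T 0 = id_blinfun \<and>
    (\<forall>s\<ge>0. \<forall>t\<ge>0. T (s + t) = T s o\<^sub>L T t) \<and>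
    (\<forall>x. ((\<lambda>t. blinfun_apply (T t) x) \<longlongrightarrow> x) (at_right 0))"

definition generator :: "(real \<Rightarrow> ('a::complex_banach \<Rightarrow>\<^sub>L 'a)) \<Rightarrow> 'a operator"
  where "generator T =
    {(x, y). ((\<lambda>t. (1 / t) *\<^sub>R (blinfun_apply (T t) x - x)) \<longlongrightarrow> y) (at_right 0)}"

text \<open>\<^term>\<open>Arg 0 = 0\<close> in the library, so the vertex has to be excluded explicitly.\<close>

definition sector :: "real \<Rightarrow> complex set"
  where "sector \<theta> = {z. z \<noteq> 0 \<and> \<bar>Arg z\<bar> < \<theta>}"

text \<open>
  Analyticity of an operator-valued function on an open set is complex differentiability of all
  orbits, which is equivalent to complex differentiability in operator norm.
\<close>

definition analytic_ops_on :: "(complex \<Rightarrow> ('a::complex_banach \<Rightarrow>\<^sub>L 'a)) \<Rightarrow> complex set \<Rightarrow> bool"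
  where "analytic_ops_on S U \<longleftrightarrow>
    (\<forall>z\<in>U. clinear_blinfun (S z)) \<and>
    (\<forall>x. \<forall>z\<in>U. \<exists>d. ((\<lambda>w. blinfun_apply (S w) x) has_derivative (\<lambda>h. h *\<^sub>C d)) (at z))"

definition bounded_analytic_C0_semigroup :: "(real \<Rightarrow> ('a::complex_banach \<Rightarrow>\<^sub>L 'a)) \<Rightarrow> bool"
  where "bounded_analytic_C0_semigroup T \<longleftrightarrow>
    C0_semigroup T \<and>
    (\<exists>\<theta>. 0 < \<theta> \<and> \<theta> \<le> pi / 2 \<and>
      (\<exists>S. analytic_ops_on S (sector \<theta>) \<and>
           (\<forall>t>0. S (complex_of_real t) = T t) \<and>
           (\<forall>\<theta>'. 0 < \<theta>' \<and> \<theta>' < \<theta> \<longrightarrow> bounded (S ` sector \<theta>'))))"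


section \<open>Fractional powers\<close>

text \<open>
  Balakrishnan's operator for \<open>0 < \<alpha> < 1\<close>: its domain is that of \<open>A\<close>, and it maps \<open>x\<close> to
  \<open>sin (\<pi> \<alpha>) / \<pi>\<close> times the integral over \<open>s > 0\<close> of \<open>s\<^bsup>\<alpha> - 1\<^esup> (s + A)\<^bsup>-1\<^esup> A x\<close>.
\<close>

definition balakrishnan :: "'a::complex_banach operator \<Rightarrow> real \<Rightarrow> 'a operator"
  where "balakrishnan A \<alpha> =
    {(x, (sin (pi * \<alpha>) / pi) *\<^sub>R y) | x y. \<exists>v. (x, v) \<in> A \<and>
      ((\<lambda>s. (s powr (\<alpha> - 1)) *\<^sub>R blinfun_apply (bounded_op ((op_affine s 1 A)\<inverse>)) v)
        has_integral y) {0<..}}"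

text \<open>
  Fractional powers of exponent \<open>\<alpha> \<in> [0,1]\<close> of a densely defined sectorial operator. For
  \<open>0 < \<alpha> < 1\<close> the domain of \<open>A\<close> is a core of \<open>A\<^bsup>\<alpha>\<^esup>\<close>, so that \<open>A\<^bsup>\<alpha>\<^esup>\<close> is the closure of Balakrishnan's
  operator; \<open>A\<close> need not be injective.
\<close>

definition frac_power :: "'a::complex_banach operator \<Rightarrow> real \<Rightarrow> 'a operator"
  where "frac_power A \<alpha> =
    (if \<alpha> = 0 then Id else if \<alpha> = 1 then A else closure (balakrishnan A \<alpha>))"


section \<open>Approximants\<close>

text \<open>\<open>exp (- n t A (n + A)\<^bsup>-1\<^esup>)\<close>\<close>

definition yosida_approx :: "'a::complex_banach operator \<Rightarrow> nat \<Rightarrow> real \<Rightarrow> ('a \<Rightarrow>\<^sub>L 'a)"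
  where "yosida_approx A n t =
    blinfun_exp (- (real n * t) *\<^sub>R bounded_op ((op_affine (real n) 1 A)\<inverse> O A))"

text \<open>\<open>exp (- n t (1 - T (1/n)))\<close>\<close>

definition dunford_segal_approx :: "(real \<Rightarrow> ('a::complex_banach \<Rightarrow>\<^sub>L 'a)) \<Rightarrow> nat \<Rightarrow> real \<Rightarrow> ('a \<Rightarrow>\<^sub>L 'a)"
  where "dunford_segal_approx T n t =
    blinfun_exp (- (real n * t) *\<^sub>R (id_blinfun - T (1 / real n)))"

text \<open>\<open>(1 + (t/n) A)\<^bsup>-n\<^esup>\<close>\<close>

definition euler_approx :: "'a::complex_banach operator \<Rightarrow> nat \<Rightarrow> real \<Rightarrow> ('a \<Rightarrow>\<^sub>L 'a)"
  where "euler_approx A n t =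
    blinfun_power (bounded_op ((op_affine 1 (t / real n) A)\<inverse>)) n"

end

theory Submission
  imports Defs "HOL-Complex_Analysis.Complex_Analysis"
begin

text \<open>
  Each approximant is the mean of \<open>e\<^bsup>-SA\<^esup> x\<close> over a random time \<open>S \<ge> 0\<close> with mean \<open>t\<close>: a Gamma variable
  for Euler, a scaled Poisson variable for Dunford-Segal, and a Poisson mixture of Gamma variables for
  Yosida. Its variance \<open>\<sigma>\<^sup>2\<close> is \<open>t\<^sup>2/n\<close>, \<open>t/n\<close> and \<open>2t/n\<close>. Analyticity bounds \<open>A e\<^bsup>-sA\<^esup>\<close> by \<open>C/s\<close>, so that the
  first order Taylor remainder of the orbit at \<open>t\<close> is at most \<open>C (s - t)\<^sup>2/t\<^sup>2 \<parallel>x\<parallel>\<close> and at most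
  \<open>C (s - t)\<^sup>2/t \<parallel>A x\<parallel>\<close>, for all \<open>s \<ge> 0\<close>. Taking means gives the errors \<open>C \<sigma>\<^sup>2/t\<^sup>2 \<parallel>x\<parallel>\<close> and \<open>C \<sigma>\<^sup>2/t \<parallel>A x\<parallel>\<close>,
  which are the cases \<open>\<alpha> = 0\<close> and \<open>\<alpha> = 1\<close>.

  For \<open>0 < \<alpha> < 1\<close> it remains to interpolate, for which \<open>\<parallel>x - e\<^bsup>-sA\<^esup> x\<parallel> \<le> C s\<^bsup>\<alpha>\<^esup> \<parallel>A\<^bsup>\<alpha>\<^esup> x\<parallel>\<close> suffices, uniformly
  in \<open>\<alpha>\<close>. By Abel inversion, \<open>\<Gamma>(\<alpha>) (x - e\<^bsup>-sA\<^esup> x)\<close> is the integral of \<open>e\<^bsup>-uA\<^esup> A\<^bsup>\<alpha>\<^esup> x\<close> against the kernel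
  \<open>u\<^bsup>\<alpha> - 1\<^esup> - (u - s)\<^bsup>\<alpha> - 1\<^esup>\<close> (positive parts), whose \<open>L\<^sup>1\<close> norm is of order \<open>s\<^bsup>\<alpha>\<^esup>/\<alpha>\<close>. Banach-space valued integrals
  are reduced to scalar ones by norming functionals.
\<close>


section \<open>Norming functionals\<close>

text \<open>Scaling is demanded only as an inequality for positive factors, a form that infima
  inherit directly; equality follows by using it for \<open>c\<close> and for
  \<open>1 / c\<close>.\<close>

definition sublinear :: "('a::real_vector \<Rightarrow> real) \<Rightarrow> bool"
  where "sublinear p \<longleftrightarrow>
    (\<forall>x y. p (x + y) \<le> p x + p y) \<and> (\<forall>c>0. \<forall>x. p (c *\<^sub>R x) \<le> c * p x)"

lemma sublinear_scale:
  assumes "sublinear p" "c > 0" shows "p (c *\<^sub>R x) = c * p x"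
proof -
  have "p ((1 / c) *\<^sub>R c *\<^sub>R x) \<le> (1 / c) * p (c *\<^sub>R x)"
    using assms unfolding sublinear_def by (meson zero_less_divide_1_iff)
  then have "c * p x \<le> p (c *\<^sub>R x)"
    using assms by (simp add: field_simps)
  then show ?thesis
    using assms unfolding sublinear_def by (meson order_antisym)
qed

lemma sublinear_zero: "sublinear p \<Longrightarrow> p 0 = 0"
  using sublinear_scale[of p 2 0] by simp

lemma sublinear_minus: "sublinear p \<Longrightarrow> - p (- x) \<le> p x"
proof -
  assume p: "sublinear p"
  then have "p (x + - x) \<le> p x + p (- x)" unfolding sublinear_def by blast
  then show ?thesis using sublinear_zero[OF p] by simp
qed

text \<open>The extension step of Hahn-Banach without subspaces: \<open>q\<close> lies below
  \<open>p\<close>, and \<open>t = 1\<close> forces \<open>q (- y)\<close> down to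
  \<open>- p y\<close>. The infimum is finite because \<open>p (t *\<^sub>R y)\<close> exceeds
  \<open>p (x + t *\<^sub>R y)\<close> by at most \<open>p (- x)\<close>.\<close>

lemma sublinear_push:
  fixes p :: "'a::real_vector \<Rightarrow> real" and y :: 'a
  assumes p: "sublinear p"
  defines "q \<equiv> \<lambda>x. INF t\<in>{0..}. p (x + t *\<^sub>R y) - t * p y"
  shows "sublinear q" "q x \<le> p x" "t \<ge> 0 \<Longrightarrow> q x \<le> p (x + t *\<^sub>R y) - t * p y"
proof -
  have add: "p (u + v) \<le> p u + p v" for u v
    using p by (simp add: sublinear_def)
  have bnd: "- p (- x) \<le> p (x + t *\<^sub>R y) - t * p y" if "t \<ge> 0" for x t
  proof -
    have "p (t *\<^sub>R y) = t * p y"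
      using that sublinear_scale[OF p] sublinear_zero[OF p] by (cases "t = 0") auto
    then show ?thesis
      using add[of "x + t *\<^sub>R y" "- x"] by simp
  qed
  then have bdd: "bdd_below ((\<lambda>t. p (x + t *\<^sub>R y) - t * p y) ` {0..})" for x
    by (meson atLeast_iff bdd_belowI2)
  have greatest: "c \<le> q x" if "\<And>t. t \<ge> 0 \<Longrightarrow> c \<le> p (x + t *\<^sub>R y) - t * p y" for c x
    unfolding q_def using that by (intro cINF_greatest) auto
  show le: "q x \<le> p (x + t *\<^sub>R y) - t * p y" if "t \<ge> 0" for x t
    unfolding q_def using that by (intro cINF_lower[OF bdd]) auto
  then show "q x \<le> p x" using le[of 0 x] by simp
  show "sublinear q"
    unfolding sublinear_def
  proof safe
    fix u v :: 'a
    \<comment> \<open>Parameters \<open>s\<close> for \<open>u\<close> and \<open>t\<close> for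
      \<open>v\<close> combine to \<open>s + t\<close> for \<open>u + v\<close>; the two infima are
      then taken one after the other.\<close>
    have "q (u + v) - (p (v + t *\<^sub>R y) - t * p y) \<le> p (u + s *\<^sub>R y) - s * p y"
      if "s \<ge> 0" "t \<ge> 0" for s t
      using le[of "s + t" "u + v"] add[of "u + s *\<^sub>R y" "v + t *\<^sub>R y"] that
      by (simp add: algebra_simps)
    then have "q (u + v) - (p (v + t *\<^sub>R y) - t * p y) \<le> q u" if "t \<ge> 0" for t
      using that by (intro greatest)
    then have "q (u + v) - q u \<le> p (v + t *\<^sub>R y) - t * p y" if "t \<ge> 0" for t
      using that by fastforce
    then have "q (u + v) - q u \<le> q v"
      by (intro greatest)
    then show "q (u + v) \<le> q u + q v" by simp
  next
    fix c :: real and u :: 'a assume c: "c > 0"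
    have "q (c *\<^sub>R u) / c \<le> p (u + t *\<^sub>R y) - t * p y" if "t \<ge> 0" for t
      using le[of "c * t" "c *\<^sub>R u"] sublinear_scale[OF p c, of "u + t *\<^sub>R y"] c that
      by (simp add: field_simps)
    then have "q (c *\<^sub>R u) / c \<le> q u"
      by (intro greatest)
    then show "q (c *\<^sub>R u) \<le> c * q u" using c by (simp add: field_simps)
  qed
qed

text \<open>Zorn's lemma for the reversed order \<open>?P\<close>. The bound of a chain is its
  pointwise infimum, finite because every member is at least \<open>- p0 (- x)\<close> at
  \<open>x\<close>.\<close>

lemma minimal_sublinear_exists:
  fixes p0 :: "'a::real_vector \<Rightarrow> real"
  assumes p0: "sublinear p0"
  shows "\<exists>p. sublinear p \<and> p \<le> p0 \<and> (\<forall>q. sublinear q \<and> q \<le> p \<longrightarrow> q = p)"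
proof -
  let ?A = "{p. sublinear p \<and> p \<le> p0}"
  let ?P = "\<lambda>p q :: 'a \<Rightarrow> real. q \<le> p"
  have "\<exists>m\<in>?A. \<forall>a\<in>?A. ?P m a \<longrightarrow> a = m"
  proof (rule predicate_Zorn)
    show "partial_order_on ?A (relation_of ?P ?A)"
      by (rule partial_order_on_relation_ofI) auto
  next
    fix C assume C: "C \<in> Chains (relation_of ?P ?A)"
    have CA: "p \<in> ?A" if "p \<in> C" for p
      using C that unfolding Chains_def relation_of_def by fastforce
    have tot: "p \<le> q \<or> q \<le> p" if "p \<in> C" "q \<in> C" for p q
      using C that unfolding Chains_def relation_of_def by fastforce
    show "\<exists>u\<in>?A. \<forall>a\<in>C. ?P a u"
    proof (cases "C = {}")
      case True
      then show ?thesis using p0 by auto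
    next
      case False
      define u where "u = (\<lambda>x. INF p\<in>C. p x)"
      have "- p0 (- x) \<le> p x" if "p \<in> C" for p x
      proof -
        have "p (- x) \<le> p0 (- x)" using CA[OF that] by (simp add: le_funD)
        then show ?thesis using sublinear_minus[of p x] CA[OF that] by simp
      qed
      then have bdd: "bdd_below ((\<lambda>p. p x) ` C)" for x by (meson bdd_belowI2)
      have le: "u x \<le> p x" if "p \<in> C" for p x
        unfolding u_def by (rule cINF_lower[OF bdd that])
      have greatest: "c \<le> u x" if "\<And>p. p \<in> C \<Longrightarrow> c \<le> p x" for c x
        unfolding u_def using False that by (intro cINF_greatest) auto
      have "sublinear u"
        unfolding sublinear_def
      proof safe
        fix x y :: 'a
        \<comment> \<open>Infima of sublinear maps need not be subadditive. Here two members of the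
          chain have a common lower bound \<open>r\<close> in the chain, whose subadditivity
          applies.\<close>
        have *: "u (x + y) - q y \<le> p x" if pq: "p \<in> C" "q \<in> C" for p q
        proof -
          obtain r where r: "r \<in> C" "r \<le> p" "r \<le> q" using tot[OF pq] pq by blast
          then have "r (x + y) \<le> r x + r y" using CA by (auto simp: sublinear_def)
          then show ?thesis
            using le[OF r(1), of "x + y"] le_funD[OF r(2), of x] le_funD[OF r(3), of y] by linarith
        qed
        have "u (x + y) - q y \<le> u x" if "q \<in> C" for q
          using *[OF _ that] by (intro greatest)
        then have "u (x + y) - u x \<le> q y" if "q \<in> C" for q using that by fastforce
        then have "u (x + y) - u x \<le> u y"
          by (intro greatest)
        then show "u (x + y) \<le> u x + u y" by simp
      next
        fix c :: real and x :: 'a assume c: "c > 0"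
        have "u (c *\<^sub>R x) / c \<le> p x" if "p \<in> C" for p
          using le[OF that, of "c *\<^sub>R x"] sublinear_scale[of p c x] CA[OF that] c
          by (simp add: field_simps)
        then have "u (c *\<^sub>R x) / c \<le> u x"
          by (intro greatest)
        then show "u (c *\<^sub>R x) \<le> c * u x" using c by (simp add: field_simps)
      qed
      moreover have "u \<le> p0"
      proof (rule le_funI)
        fix x
        obtain p where "p \<in> C" using False by blast
        then show "u x \<le> p0 x" using CA[of p] le[of p x] by (auto dest!: le_funD[of p p0 x])
      qed
      ultimately show ?thesis using le by (auto simp: le_fun_def)
    qed
  qed
  then obtain p where p: "sublinear p" "p \<le> p0"
    and min: "\<And>q. sublinear q \<Longrightarrow> q \<le> p0 \<Longrightarrow> q \<le> p \<Longrightarrow> q = p"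
    by blast
  then show ?thesis using order_trans[OF _ p(2)] by blast
qed

text \<open>Pushing a minimal \<open>p\<close> along \<open>y\<close> does not change it, so \<open>p x \<le> p (x + y) - p y\<close>.\<close>

lemma minimal_sublinear_linear:
  assumes p: "sublinear p" and min: "\<And>q. sublinear q \<Longrightarrow> q \<le> p \<Longrightarrow> q = p"
  shows "linear p"
proof -
  have add: "p (x + y) = p x + p y" for x y
  proof -
    have "(\<lambda>x. INF t\<in>{0..}. p (x + t *\<^sub>R y) - t * p y) = p"
      using sublinear_push(1,2)[OF p] by (intro min) (auto simp: le_fun_def)
    then have "p x \<le> p (x + y) - p y"
      using sublinear_push(3)[OF p, of 1 x y] by (simp add: fun_eq_iff)
    moreover have "p (x + y) \<le> p x + p y" using p unfolding sublinear_def by blast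
    ultimately show ?thesis by simp
  qed
  then have neg: "p (- x) = - p x" for x
    using sublinear_zero[OF p] add[of x "- x"] by simp
  show ?thesis
  proof (rule linearI)
    fix c x
    show "p (c *\<^sub>R x) = c *\<^sub>R p x"
      using sublinear_scale[OF p, of c x] sublinear_scale[OF p, of "- c" x] sublinear_zero[OF p] neg
      by (cases c "0::real" rule: linorder_cases) auto
  qed (rule add)
qed

text \<open>Pushing the norm along \<open>d\<close> yields a sublinear \<open>p0\<close> with
  \<open>p0 (- d) \<le> - norm d\<close>. A minimal functional below \<open>p0\<close> is linear and
  inherits this bound at \<open>- d\<close>, hence attains the norm at \<open>d\<close>.\<close>

theorem norming_functional:
  fixes d :: "'a::real_normed_vector"
  shows "\<exists>f. bounded_linear f \<and> (\<forall>x. \<bar>f x\<bar> \<le> norm x) \<and> f d = norm d"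
proof -
  have nrm: "sublinear (norm :: 'a \<Rightarrow> real)"
    unfolding sublinear_def by (simp add: norm_triangle_ineq)
  define p0 where "p0 = (\<lambda>x::'a. INF t\<in>{0..}. norm (x + t *\<^sub>R d) - t * norm d)"
  have p0: "sublinear p0" and p0n: "p0 x \<le> norm x" for x
    unfolding p0_def using sublinear_push[OF nrm] by auto
  have p0d: "p0 (- d) \<le> - norm d"
    unfolding p0_def using sublinear_push(3)[OF nrm, of 1 "- d" d] by simp
  obtain f where f: "sublinear f" "f \<le> p0" "\<And>q. sublinear q \<Longrightarrow> q \<le> f \<Longrightarrow> q = f"
    using minimal_sublinear_exists[OF p0] by metis
  have lin: "linear f" by (rule minimal_sublinear_linear) (use f in auto)
  have le: "f x \<le> norm x" for x using le_funD[OF f(2), of x] p0n[of x] by linarith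
  have abs: "\<bar>f x\<bar> \<le> norm x" for x
    using le[of x] le[of "- x"] linear_neg[OF lin, of x] by simp
  have "f (- d) \<le> - norm d" using le_funD[OF f(2), of "- d"] p0d by linarith
  then have "f d = norm d" using le[of d] linear_neg[OF lin, of d] by simp
  moreover have "bounded_linear f"
    using lin abs by (intro bounded_linear_intro[where K = 1]) (auto simp: linear_add linear_scale)
  ultimately show ?thesis using abs by blast
qed

corollary norm_le_functionals:
  fixes x :: "'a::real_normed_vector"
  assumes "\<And>f. bounded_linear f \<Longrightarrow> (\<And>y. \<bar>f y\<bar> \<le> norm y) \<Longrightarrow> \<bar>f x\<bar> \<le> B"
  shows "norm x \<le> B"
  using norming_functional[of x] assms by (metis abs_norm_cancel)

section \<open>Cauchy estimates\<close>

text \<open>The norming functional \<open>f\<close> is only real-linear. The map \<open>g\<close>,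
  with real part \<open>f\<close>, is complex-linear, so Cauchy's estimate applies to the scalar
  holomorphic function \<open>g (F z)\<close>. The bound of \<open>g\<close> by twice the norm gives
  the factor 2.\<close>

lemma cauchy_estimate:
  fixes F :: "complex \<Rightarrow> 'a::complex_normed_vector"
  assumes r: "r > 0"
    and der: "\<And>z. z \<in> cball z0 r \<Longrightarrow> \<exists>d. (F has_derivative (\<lambda>h. h *\<^sub>C d)) (at z)"
    and d: "(F has_derivative (\<lambda>h. h *\<^sub>C d)) (at z0)"
    and B: "\<And>z. z \<in> cball z0 r \<Longrightarrow> norm (F z) \<le> B"
  shows "norm d \<le> 2 * B / r"
proof (rule field_le_epsilon)
  \<comment> \<open>The scalar estimate asks for values in an open ball, so \<open>B\<close> is
    enlarged by \<open>e\<close>, chosen such that \<open>2 * e / r\<close> equals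
    \<open>e'\<close>.\<close>
  fix e' :: real assume e': "e' > 0"
  define e where "e = e' * r / 2"
  have e: "e > 0" using e' r by (simp add: e_def)
  obtain f where f: "bounded_linear f" "\<And>x. \<bar>f x\<bar> \<le> norm x" "f d = norm d"
    using norming_functional[of d] by blast
  interpret f: bounded_linear f by (rule f)
  define g where "g = (\<lambda>x. Complex (f x) (- f (\<i> *\<^sub>C x)))"
  have i2: "\<i> *\<^sub>C \<i> *\<^sub>C (x::'a) = - x" for x
    using scaleR_scaleC[of "-1" x] by (simp add: scaleC_scaleC)
  have gc: "g (c *\<^sub>C x) = c * g x" for c x
  proof -
    have c: "c = of_real (Re c) + of_real (Im c) * \<i>" by (simp add: complex_eq_iff)
    have 1: "c *\<^sub>C x = Re c *\<^sub>R x + Im c *\<^sub>R \<i> *\<^sub>C x" for x :: 'a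
      unfolding scaleR_scaleC scaleC_scaleC scaleC_add_left[symmetric] c[symmetric] ..
    have 2: "\<i> *\<^sub>C c *\<^sub>C x = c *\<^sub>C \<i> *\<^sub>C x"
      unfolding scaleC_scaleC by (simp only: mult.commute)
    have "f (\<i> *\<^sub>C c *\<^sub>C x) = Re c * f (\<i> *\<^sub>C x) - Im c * f x"
      unfolding 2 1[of "\<i> *\<^sub>C x"] i2 by (simp add: f.add f.scale f.diff)
    moreover have "f (c *\<^sub>C x) = Re c * f x + Im c * f (\<i> *\<^sub>C x)"
      unfolding 1 by (simp add: f.add f.scale)
    ultimately show ?thesis
      unfolding g_def by (simp add: complex_eq_iff)
  qed
  have gn: "cmod (g x) \<le> 2 * norm x" for x
    using cmod_le[of "g x"] f(2)[of x] f(2)[of "\<i> *\<^sub>C x"] norm_scaleC[of "\<i>" x] unfolding g_def by auto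
  have gbl: "bounded_linear g"
  proof (rule bounded_linear_intro[where K = 2])
    show "g (x + y) = g x + g y" for x y
      unfolding g_def by (simp add: scaleC_add_right f.add complex_eq_iff)
    show "g (r *\<^sub>R x) = r *\<^sub>R g x" for r x
      unfolding scaleR_scaleC gc by (simp add: scaleR_conv_of_real)
  qed (use gn in \<open>simp add: mult.commute\<close>)
  have fd: "((\<lambda>z. g (F z)) has_field_derivative g e) (at z)"
    if "(F has_derivative (\<lambda>h. h *\<^sub>C e)) (at z)" for z e
  proof -
    have "(*) (g e) = (\<lambda>h. g (h *\<^sub>C e))" by (auto simp: gc mult.commute)
    then show ?thesis
      using bounded_linear.has_derivative[OF gbl that] unfolding has_field_derivative_def by simp
  qed
  have hol: "(\<lambda>z. g (F z)) field_differentiable at z" if z: "z \<in> cball z0 r" for z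
  proof -
    obtain e where "(F has_derivative (\<lambda>h. h *\<^sub>C e)) (at z)" using der[OF z] ..
    then show ?thesis unfolding field_differentiable_def by (intro exI) (rule fd)
  qed
  have cont: "continuous_on (cball z0 r) (\<lambda>z. g (F z))"
    by (intro continuous_at_imp_continuous_on ballI field_differentiable_imp_continuous_at hol)
  have "cmod ((deriv ^^ 1) (\<lambda>z. g (F z)) z0) \<le> fact 1 * (2 * (B + e)) / r ^ 1"
  proof (rule Cauchy_higher_deriv_bound[OF _ cont])
    show "(\<lambda>z. g (F z)) holomorphic_on ball z0 r"
      unfolding holomorphic_on_def using hol by (simp add: field_differentiable_at_within)
    show "g (F w) \<in> ball 0 (2 * (B + e))" if "w \<in> ball z0 r" for w
      using gn[of "F w"] B[of w] that e by auto
  qed (use r in auto)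
  moreover have "deriv (\<lambda>z. g (F z)) z0 = g d" by (rule DERIV_imp_deriv[OF fd[OF d]])
  moreover have "norm d \<le> cmod (g d)"
    using complex_Re_le_cmod[of "g d"] f(3) by (simp add: g_def)
  moreover have "2 * (B + e) / r = 2 * B / r + e'" using r by (simp add: e_def field_simps)
  ultimately show "norm d \<le> 2 * B / r + e'" by simp
qed

text \<open>Sectors are invariant under positive dilations: a disc around 1, found by continuity of
  \<open>Arg\<close> there, is scaled by \<open>t\<close>.\<close>

lemma sector_ball:
  assumes "0 < \<theta>"
  shows "\<exists>\<rho>>0. \<forall>t>0. cball (complex_of_real t) (\<rho> * t) \<subseteq> sector \<theta>"
proof -
  have "continuous (at 1) Arg" by (rule continuous_at_Arg) auto
  then obtain \<delta> where \<delta>: "\<delta> > 0" "\<And>z. dist z 1 < \<delta> \<Longrightarrow> dist (Arg z) (Arg 1) < \<theta>"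
    using assms unfolding continuous_at_eps_delta by metis
  \<comment> \<open>Halving \<delta> turns the closed disc into a strict inequality; the bound 1/2
    keeps \<open>w\<close> away from the vertex 0.\<close>
  define \<rho> where "\<rho> = min (\<delta> / 2) (1/2)"
  have "z \<in> sector \<theta>" if t: "t > 0" and z: "dist (complex_of_real t) z \<le> \<rho> * t" for t z
  proof -
    define w where "w = z / of_real t"
    have zw: "z = of_real t * w" using t by (simp add: w_def)
    have "dist (complex_of_real t) z = t * cmod (1 - w)"
      unfolding zw dist_norm using t norm_mult[of "complex_of_real t" "1 - w"]
      by (simp add: right_diff_distrib)
    then have "t * cmod (1 - w) \<le> t * \<rho>"
      using z by (simp add: mult.commute)
    then have w: "cmod (1 - w) \<le> \<rho>"
      using t by simp
    then have "dist w 1 < \<delta>"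
      using \<delta>(1) unfolding \<rho>_def by (simp add: dist_norm norm_minus_commute)
    then have "\<bar>Arg w\<bar> < \<theta>" using \<delta>(2)[of w] by (simp add: dist_real_def)
    moreover have "w \<noteq> 0" using w unfolding \<rho>_def by auto
    moreover have "Arg z = Arg w" unfolding zw using t by (rule Arg_times_of_real)
    ultimately show ?thesis using t unfolding sector_def zw by auto
  qed
  moreover have "\<rho> > 0" using \<delta> by (simp add: \<rho>_def)
  ultimately show ?thesis by (auto simp: cball_def)
qed


section \<open>Bounded analytic semigroups and resolvents\<close>

lemma has_vector_derivative_right_quotient:
  assumes "(f has_vector_derivative d) (at x within S)" "at_right x \<le> at x within S"
  shows "((\<lambda>h. (1 / h) *\<^sub>R (f (x + h) - f x)) \<longlongrightarrow> d) (at_right 0)"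
proof -
  have "((\<lambda>y. norm (f y - f x - (y - x) *\<^sub>R d) / norm (y - x)) \<longlongrightarrow> 0) (at x within S)"
    using assms(1) unfolding has_vector_derivative_def has_derivative_iff_norm by simp
  then have "((\<lambda>y. norm (f y - f x - (y - x) *\<^sub>R d) / norm (y - x)) \<longlongrightarrow> 0) (at_right x)"
    by (rule tendsto_mono[OF assms(2)])
  then have "((\<lambda>h. norm (f (h + x) - f x - h *\<^sub>R d) / norm h) \<longlongrightarrow> 0) (at_right 0)"
    unfolding filterlim_at_right_to_0[of _ _ x] by simp
  moreover have "\<forall>\<^sub>F h in at_right 0. norm (f (h + x) - f x - h *\<^sub>R d) / norm h
      = norm ((1 / h) *\<^sub>R (f (x + h) - f x) - d)"
    unfolding eventually_at_right_field
  proof (intro exI[of _ 1] conjI allI impI)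
    fix h :: real assume h: "0 < h" "h < 1"
    have "(1 / h) *\<^sub>R (f (x + h) - f x) - d = (1 / h) *\<^sub>R (f (h + x) - f x - h *\<^sub>R d)"
      using h by (simp add: scaleR_diff_right add.commute)
    then show "norm (f (h + x) - f x - h *\<^sub>R d) / norm h
      = norm ((1 / h) *\<^sub>R (f (x + h) - f x) - d)" using h by simp
  qed auto
  ultimately have "((\<lambda>h. norm ((1 / h) *\<^sub>R (f (x + h) - f x) - d)) \<longlongrightarrow> 0) (at_right 0)"
    by (rule Lim_transform_eventually)
  then show ?thesis
    by (rule LIM_zero_cancel[OF tendsto_norm_zero_cancel])
qed

lemma mean_value_bound:
  fixes f :: "real \<Rightarrow> 'a::real_normed_vector"
  assumes "a \<le> b" "continuous_on {a..b} f"
    and "\<And>x. a < x \<Longrightarrow> x < b \<Longrightarrow> \<exists>d. (f has_vector_derivative d) (at x) \<and> norm d \<le> K"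
  shows "norm (f b - f a) \<le> K * (b - a)"
proof (cases "a = b")
  case False
  obtain f' where f': "\<And>x. a < x \<Longrightarrow> x < b \<Longrightarrow> (f has_vector_derivative f' x) (at x) \<and> norm (f' x) \<le> K"
    using assms(3) by metis
  have "norm (f b - f a) \<le> K * b - K * a"
    by (rule differentiable_bound_general[where f' = f' and \<phi>' = "\<lambda>_. K"])
      (use False assms f' in \<open>auto intro!: continuous_intros derivative_eq_intros\<close>)
  then show ?thesis by (simp add: right_diff_distrib)
qed simp

lemma exp_decay: 
  assumes "h > 0"
  shows "((\<lambda>b. exp (- b / h) * (c + b * d)) \<longlongrightarrow> (0::real)) at_top"
proof -
  have lim: "filterlim (\<lambda>b. b / h) at_top at_top"
    using filterlim_tendsto_pos_mult_at_top[OF tendsto_const[of "1 / h"] _ filterlim_ident] assms by simp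
  have "((\<lambda>b. c * ((b / h) ^ 0 / exp (b / h)) + (d * h) * ((b / h) ^ 1 / exp (b / h))) \<longlongrightarrow> c * 0 + (d * h) * 0) at_top"
    by (intro tendsto_intros filterlim_compose[OF tendsto_power_div_exp_0 lim])
  moreover have "c * ((b / h) ^ 0 / exp (b / h)) + (d * h) * ((b / h) ^ 1 / exp (b / h)) = exp (- b / h) * (c + b * d)" for b
    using assms by (simp add: exp_minus field_simps)
  ultimately show ?thesis by simp
qed

text \<open>These estimates on the positive real axis carry all of the later analysis; the complex
  sector enters only through \<open>bounded_analytic_estimates\<close>. \<open>T_deriv\<close> is
  the bound of \<open>t A e^(-tA)\<close>, phrased through orbits because \<open>A\<close> is not
  yet defined.\<close>

locale analytic_semigroup =
  fixes T :: "real \<Rightarrow> ('a::complex_banach \<Rightarrow>\<^sub>L 'a)" and M M1 :: real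
  assumes T_0 [simp]: "T 0 = id_blinfun"
    and T_add: "s \<ge> 0 \<Longrightarrow> t \<ge> 0 \<Longrightarrow> T (s + t) x = T s (T t x)"
    and T_lim: "((\<lambda>t. T t x) \<longlongrightarrow> x) (at_right 0)"
    and T_norm: "t \<ge> 0 \<Longrightarrow> norm (T t x) \<le> M * norm x"
    and T_deriv: "t > 0 \<Longrightarrow> \<exists>d. ((\<lambda>r. T r x) has_vector_derivative d) (at t) \<and> norm d \<le> M1 / t * norm x"
    and M: "M \<ge> 1" and M1: "M1 \<ge> 1"
begin

section \<open>The operator A and calculus along its orbits\<close>

definition A :: "'a operator"
  where "A = op_affine 0 (-1) (generator T)"

lemma A_iff: "(x, y) \<in> A \<longleftrightarrow> ((\<lambda>h. (1 / h) *\<^sub>R (T h x - x)) \<longlongrightarrow> - y) (at_right 0)"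
  unfolding A_def op_affine_def generator_def by (auto intro: exI[of _ "- y"])

lemma A_unique: "(x, y) \<in> A \<Longrightarrow> (x, y') \<in> A \<Longrightarrow> y = y'"
  unfolding A_iff using tendsto_unique[OF trivial_limit_at_right_real, of _ "- y" 0 "- y'"] by simp

lemma A_add_scale:
  assumes "(x, y) \<in> A" "(x', y') \<in> A"
  shows "(x + c *\<^sub>R x', y + c *\<^sub>R y') \<in> A"
proof -
  have "((\<lambda>h. (1 / h) *\<^sub>R (T h x - x) + c *\<^sub>R (1 / h) *\<^sub>R (T h x' - x')) \<longlongrightarrow> - y + c *\<^sub>R (- y')) (at_right 0)"
    using assms unfolding A_iff by (intro tendsto_intros)
  moreover have "(1 / h) *\<^sub>R (T h x - x) + c *\<^sub>R (1 / h) *\<^sub>R (T h x' - x') = (1 / h) *\<^sub>R (T h (x + c *\<^sub>R x') - (x + c *\<^sub>R x'))" for h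
    by (simp add: blinfun.bilinear_simps algebra_simps)
  ultimately show ?thesis unfolding A_iff by simp
qed

lemma A_0: "(0, 0) \<in> A"
  unfolding A_iff by (simp add: blinfun.bilinear_simps)

lemma T_cont: "continuous_on {0..} (\<lambda>t. T t x)"
proof (rule continuous_on_eq_continuous_within[THEN iffD2], rule ballI)
  fix t :: real assume "t \<in> {0..}"
  then consider "t = 0" | "t > 0" by fastforce
  then show "continuous (at t within {0..}) (\<lambda>t. T t x)"
  proof cases
    case 1
    then show ?thesis using T_lim[of x] by (simp add: continuous_within at_within_Ici_at_right)
  next
    case 2
    then show ?thesis
      using T_deriv[of t x] by (auto intro: continuous_at_imp_continuous_at_within has_vector_derivative_continuous)
  qed
qed

lemma T_cont_on: "S \<subseteq> {0..} \<Longrightarrow> continuous_on S (\<lambda>t. T t x)"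
  using continuous_on_subset[OF T_cont] .

lemma T_quotient:
  assumes "t \<ge> 0" "((\<lambda>r. T r x) has_vector_derivative d) (at t)"
  shows "((\<lambda>h. (1 / h) *\<^sub>R (T h (T t x) - T t x)) \<longlongrightarrow> d) (at_right 0)"
proof (rule Lim_transform_eventually)
  show "((\<lambda>h. (1 / h) *\<^sub>R (T (t + h) x - T t x)) \<longlongrightarrow> d) (at_right 0)"
    by (rule has_vector_derivative_right_quotient[OF assms(2)]) (simp add: at_le)
  show "\<forall>\<^sub>F h in at_right 0. (1 / h) *\<^sub>R (T (t + h) x - T t x) = (1 / h) *\<^sub>R (T h (T t x) - T t x)"
    unfolding eventually_at_right_field
    using T_add[of _ t x] assms(1) by (intro exI[of _ 1]) (auto simp: add.commute)
qed

lemma T_in_A: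
  assumes "t > 0" "((\<lambda>r. T r x) has_vector_derivative d) (at t)"
  shows "(T t x, - d) \<in> A"
  using T_quotient[OF _ assms(2)] assms(1) unfolding A_iff by simp

lemma A_commute:
  assumes "(x, v) \<in> A" "t \<ge> 0" shows "(T t x, T t v) \<in> A"
proof -
  have "((\<lambda>h. T t ((1 / h) *\<^sub>R (T h x - x))) \<longlongrightarrow> T t (- v)) (at_right 0)"
    using assms(1) unfolding A_iff by (intro tendsto_intros)
  moreover have "\<forall>\<^sub>F h in at_right 0. T t ((1 / h) *\<^sub>R (T h x - x)) = (1 / h) *\<^sub>R (T h (T t x) - T t x)"
    unfolding eventually_at_right_field
    using T_add[of _ t x] T_add[of t _ x] assms(2)
    by (intro exI[of _ 1]) (auto simp: add.commute blinfun.bilinear_simps)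
  ultimately show ?thesis
    unfolding A_iff by (simp add: blinfun.bilinear_simps Lim_transform_eventually)
qed

text \<open>Analyticity supplies a two-sided derivative; its value is then identified by the
  one-sided quotient that defines the generator.\<close>

lemma T_deriv_A:
  assumes "(x, v) \<in> A" "t > 0" shows "((\<lambda>r. T r x) has_vector_derivative - T t v) (at t)"
proof -
  obtain d where d: "((\<lambda>r. T r x) has_vector_derivative d) (at t)" using T_deriv[OF assms(2)] by blast
  have "(T t x, - d) \<in> A" by (rule T_in_A[OF assms(2) d])
  then have "- d = T t v" using A_unique A_commute[OF assms(1)] assms(2) by (meson less_imp_le)
  then show ?thesis using d by (metis minus_minus)
qed

text \<open>The free vector \<open>u\<close> lets one mean value estimate serve as a Lipschitz bound
  (\<open>u = 0\<close>) and as a first order Taylor remainder (\<open>- u\<close> the expected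
  derivative).\<close>

lemma T_lipschitz_A:
  assumes "(x, v) \<in> A" "0 \<le> a" "a \<le> b" and K: "\<And>r. a < r \<Longrightarrow> r < b \<Longrightarrow> norm (T r v - u) \<le> K"
  shows "norm (T b x - T a x + (b - a) *\<^sub>R u) \<le> K * (b - a)"
proof -
  have "norm ((T b x + b *\<^sub>R u) - (T a x + a *\<^sub>R u)) \<le> K * (b - a)"
  proof (rule mean_value_bound)
    show "continuous_on {a..b} (\<lambda>r. T r x + r *\<^sub>R u)"
      using assms by (intro continuous_intros T_cont_on) auto
    show "\<exists>d. ((\<lambda>r. T r x + r *\<^sub>R u) has_vector_derivative d) (at r) \<and> norm d \<le> K" if "a < r" "r < b" for r
    proof (intro exI conjI)
      show "((\<lambda>r. T r x + r *\<^sub>R u) has_vector_derivative - T r v + (1 *\<^sub>R u)) (at r)"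
        using T_deriv_A[OF assms(1), of r] that assms(2)
        by (auto intro!: derivative_eq_intros)
      show "norm (- T r v + (1 *\<^sub>R u)) \<le> K" using K[OF that] by (simp add: norm_minus_commute)
    qed
  qed (rule assms)
  then show ?thesis by (simp add: algebra_simps)
qed

lemma T_lipschitz:
  assumes "0 < \<delta>" "\<delta> \<le> a" "\<delta> \<le> b"
  shows "norm (T b x - T a x) \<le> M1 / \<delta> * norm x * \<bar>b - a\<bar>"
proof -
  have *: "norm (T b x - T a x) \<le> M1 / \<delta> * norm x * (b - a)" if "\<delta> \<le> a" "a \<le> b" for a b
  proof (rule mean_value_bound[OF that(2)])
    show "continuous_on {a..b} (\<lambda>r. T r x)" using assms that by (intro T_cont_on) auto
    fix r assume r: "a < r" "r < b"
    then have "M1 / r * norm x \<le> M1 / \<delta> * norm x"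
      using M1 assms(1) that(1) by (intro mult_right_mono divide_left_mono) auto
    then show "\<exists>d. ((\<lambda>r. T r x) has_vector_derivative d) (at r) \<and> norm d \<le> M1 / \<delta> * norm x"
      using T_deriv[of r x] r assms(1) that(1) by (meson less_le_trans order.strict_trans order_trans)
  qed
  show ?thesis
    using *[of a b] *[of b a] assms by (cases "a \<le> b") (auto simp: norm_minus_commute)
qed

text \<open>By the mean value estimate the difference quotient of \<open>w n\<close> at
  \<open>s < \<delta>\<close> is within \<open>M * norm (g n - v) + e / 2\<close> of
  \<open>- v\<close>. As \<delta> depends only on \<open>v\<close> and \<open>e\<close>, the limit
  in \<open>n\<close> can be taken for fixed \<open>s\<close>.\<close>

lemma A_closed:
  assumes "\<And>n. (w n, g n) \<in> A" and w: "w \<longlonglongrightarrow> x" and g: "g \<longlonglongrightarrow> v"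
  shows "(x, v) \<in> A"
  unfolding A_iff
proof (rule tendstoI)
  fix e :: real assume e: "e > 0"
  have "\<forall>\<^sub>F r in at_right 0. dist (T r v) v < e / 2"
    using T_lim[of v] e by (intro tendstoD) auto
  then obtain \<delta> where \<delta>: "\<delta> > 0" "\<And>r. 0 < r \<Longrightarrow> r < \<delta> \<Longrightarrow> norm (T r v - v) < e / 2"
    unfolding eventually_at_right_field dist_norm by blast
  show "\<forall>\<^sub>F s in at_right 0. dist ((1 / s) *\<^sub>R (T s x - x)) (- v) < e"
    unfolding eventually_at_right_field
  proof (intro exI[of _ \<delta>] conjI allI impI \<delta>(1))
    fix s assume s: "0 < s" "s < \<delta>"
    have "norm (T s (w n) - T 0 (w n) + (s - 0) *\<^sub>R v) \<le> (M * norm (g n - v) + e / 2) * (s - 0)" for n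
    proof (rule T_lipschitz_A[OF assms(1)])
      fix r assume r: "0 < r" "r < s"
      have "norm (T r (g n) - v) \<le> norm (T r (g n - v)) + norm (T r v - v)"
        using norm_triangle_ineq[of "T r (g n - v)" "T r v - v"] by (simp add: blinfun.bilinear_simps)
      then show "norm (T r (g n) - v) \<le> M * norm (g n - v) + e / 2"
        using T_norm[of r "g n - v"] \<delta>(2)[of r] r s by linarith
    qed (use s in auto)
    then have "norm (T s x - x + s *\<^sub>R v) \<le> (M * norm (v - v) + e / 2) * s"
      using w g by (intro LIMSEQ_le[of "\<lambda>n. norm (T s (w n) - w n + s *\<^sub>R v)" _ "\<lambda>n. (M * norm (g n - v) + e / 2) * s"] tendsto_intros) auto
    moreover have "(1 / s) *\<^sub>R (T s x - x) - (- v) = (1 / s) *\<^sub>R (T s x - x + s *\<^sub>R v)"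
      using s by (simp add: algebra_simps)
    ultimately have "dist ((1 / s) *\<^sub>R (T s x - x)) (- v) \<le> (1 / s) * (e / 2 * s)"
      unfolding dist_norm using s by (simp add: pos_divide_le_eq)
    then show "dist ((1 / s) *\<^sub>R (T s x - x)) (- v) < e"
      using s e by simp
  qed
qed

text \<open>The truncated Laplace transform of an orbit lies in the domain. It yields the resolvent
  for \<open>l = 1 / h\<close> and \<open>N\<close> tending to infinity, and the mean of the orbit
  for \<open>l = 0\<close>.\<close>

lemma A_integral:
  fixes l N :: real and x :: 'a
  assumes N: "N \<ge> 0"
  defines "w \<equiv> integral {0..N} (\<lambda>s. exp (- l * s) *\<^sub>R T s x)"
  shows "(w, x - exp (- l * N) *\<^sub>R T N x - l *\<^sub>R w) \<in> A"
proof -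
  define f where "f = (\<lambda>s. exp (- l * s) *\<^sub>R T s x)"
  have cont: "continuous_on {0..b} f" for b
    unfolding f_def by (intro continuous_intros T_cont_on) auto
  define F where "F = (\<lambda>u. integral {0..u} f)"
  have w: "w = F N" unfolding w_def F_def f_def ..
  \<comment> \<open>\<open>T h\<close> moves the window of integration from [0, N] to [h, N + h] and
    the weight contributes \<open>exp (l * h)\<close>. The right-hand side can be differentiated at
    \<open>h = 0\<close> by the product rule.\<close>
  have TF: "T h w = exp (l * h) *\<^sub>R (F (N + h) - F h)" if h: "h \<ge> 0" for h
  proof -
    have "integral {0..h} f + integral {h..N + h} f = integral {0..N + h} f"
      using N h by (intro Henstock_Kurzweil_Integration.integral_combine integrable_continuous_real cont) auto
    then have I: "integral {h..N + h} f = F (N + h) - F h" unfolding F_def by (simp add: algebra_simps)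
    have "f integrable_on {h..N + h}"
      using h by (intro integrable_continuous_real continuous_on_subset[OF cont[of "N + h"]]) auto
    then have "(f has_integral (F (N + h) - F h)) {h..N + h}"
      using I by (metis integrable_integral)
    then have "((\<lambda>s. f (s + h)) has_integral (F (N + h) - F h)) {0..N}"
      using has_integral_shift_real_ivl[of f _ h "N + h" h] by simp
    then have "((\<lambda>s. exp (l * h) *\<^sub>R f (s + h)) has_integral (exp (l * h) *\<^sub>R (F (N + h) - F h))) {0..N}"
      by (rule has_integral_cmul)
    moreover have "exp (l * h) *\<^sub>R f (s + h) = T h (f s)" if "s \<in> {0..N}" for s
      unfolding f_def using T_add[of h s x] h that
      by (simp add: blinfun.bilinear_simps add.commute distrib_left flip: exp_add)
    ultimately have 1: "((\<lambda>s. T h (f s)) has_integral (exp (l * h) *\<^sub>R (F (N + h) - F h))) {0..N}"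
      by (rule has_integral_eq[rotated])
    have "(f has_integral w) {0..N}"
      unfolding w F_def by (intro integrable_integral integrable_continuous_real cont)
    then have "((\<lambda>s. T h (f s)) has_integral T h w) {0..N}"
      using has_integral_linear[OF _ blinfun.bounded_linear_right[of "T h"]] by (simp add: o_def)
    then show ?thesis using has_integral_unique[OF _ 1] by simp
  qed
  define G where "G = (\<lambda>h. exp (l * h) *\<^sub>R (F (N + h) - F h))"
  have dF: "(F has_vector_derivative f u) (at u within {0..b})" if "u \<in> {0..b}" for u b
    unfolding F_def by (rule integral_has_vector_derivative[OF cont that])
  have "((\<lambda>h. (1 / h) *\<^sub>R (F (N + h) - F N)) \<longlongrightarrow> f N) (at_right 0)"
    using N by (intro has_vector_derivative_right_quotient[OF dF[of N "N + 1"]])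
      (auto simp: at_within_Icc_at_right[of N "N + 1", symmetric] intro: at_le)
  moreover have "((\<lambda>h. (1 / h) *\<^sub>R (F (0 + h) - F 0)) \<longlongrightarrow> f 0) (at_right 0)"
    by (intro has_vector_derivative_right_quotient[OF dF[of 0 1]])
      (auto simp: at_within_Icc_at_right)
  moreover have "((\<lambda>h. (1 / h) *\<^sub>R (exp (l * (0 + h)) - exp (l * 0))) \<longlongrightarrow> l) (at_right 0)"
    by (rule has_vector_derivative_right_quotient[where S = UNIV])
      (auto intro!: derivative_eq_intros at_le simp: has_real_derivative_iff_has_vector_derivative[symmetric])
  moreover have "((\<lambda>h. exp (l * h)) \<longlongrightarrow> exp (l * 0)) (at_right 0)"
    by (intro tendsto_intros)
  ultimately have "((\<lambda>h. exp (l * h) *\<^sub>R ((1 / h) *\<^sub>R (F (N + h) - F N) - (1 / h) *\<^sub>R (F (0 + h) - F 0))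
      + ((1 / h) *\<^sub>R (exp (l * (0 + h)) - exp (l * 0))) *\<^sub>R F N) \<longlongrightarrow> exp (l * 0) *\<^sub>R (f N - f 0) + l *\<^sub>R F N) (at_right 0)"
    by (intro tendsto_intros)
  moreover have "\<forall>\<^sub>F h in at_right 0. exp (l * h) *\<^sub>R ((1 / h) *\<^sub>R (F (N + h) - F N) - (1 / h) *\<^sub>R (F (0 + h) - F 0))
      + ((1 / h) *\<^sub>R (exp (l * (0 + h)) - exp (l * 0))) *\<^sub>R F N = (1 / h) *\<^sub>R (T h w - w)"
    unfolding eventually_at_right_field
  proof (intro exI[of _ 1] conjI allI impI)
    fix h :: real assume h: "0 < h" "h < 1"
    have "F 0 = 0" by (simp add: F_def)
    then show "exp (l * h) *\<^sub>R ((1 / h) *\<^sub>R (F (N + h) - F N) - (1 / h) *\<^sub>R (F (0 + h) - F 0))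
      + ((1 / h) *\<^sub>R (exp (l * (0 + h)) - exp (l * 0))) *\<^sub>R F N = (1 / h) *\<^sub>R (T h w - w)"
      unfolding w TF[OF less_imp_le[OF h(1)], unfolded w]
      by (simp add: algebra_simps)
  qed auto
  ultimately have "((\<lambda>h. (1 / h) *\<^sub>R (T h w - w)) \<longlongrightarrow> exp (l * 0) *\<^sub>R (f N - f 0) + l *\<^sub>R F N) (at_right 0)"
    by (rule Lim_transform_eventually)
  then show ?thesis
    unfolding A_iff by (simp add: f_def w algebra_simps)
qed

text \<open>With \<open>w = (1 + h A)\<^bsup>-1\<^esup> x\<close>, the orbit of \<open>x\<close> is that of \<open>w\<close> minus \<open>h\<close> times its derivative, and
  \<open>(s + h - t)\<^sup>2 + h\<^sup>2\<close> is the solution of \<open>q - h q' = (s - t)\<^sup>2\<close> of polynomial growth.\<close>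

lemma resolvent_compare:
  assumes wv: "(w, v) \<in> A" and h: "h > 0" and c: "c \<ge> 0" "d \<ge> 0"
    and bnd: "\<And>s. s \<ge> 0 \<Longrightarrow> norm (T s (w + h *\<^sub>R v) - u - (s - t) *\<^sub>R z) \<le> c * (s - t)\<^sup>2 + d"
    and s: "s \<ge> 0"
  shows "norm (T s w - u - (s + h - t) *\<^sub>R z) \<le> c * ((s + h - t)\<^sup>2 + h\<^sup>2) + d"
proof -
  \<comment> \<open>With the integrating factor \<open>exp (- s / h)\<close>, the derivative of
    \<open>f\<close> contains only the orbit of \<open>w + h *\<^sub>R v\<close>, to which
    \<open>bnd\<close> applies, and \<phi> is the antiderivative of the resulting bound. Integrating
    from \<open>s\<close> to \<open>b\<close> and letting \<open>b\<close> tend to infinity removes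
    \<open>f b\<close>, which grows at most linearly before damping.\<close>
  define f where "f = (\<lambda>s. exp (- s / h) *\<^sub>R (T s w - u - (s + h - t) *\<^sub>R z))"
  define \<phi> where "\<phi> = (\<lambda>s. - (exp (- s / h) * (c * ((s + h - t)\<^sup>2 + h\<^sup>2) + d)))"
  define K where "K = M * norm w + norm u + (h + \<bar>t\<bar>) * norm z"
  have \<phi>0: "\<phi> b \<le> 0" for b unfolding \<phi>_def using c by (simp add: mult_nonneg_nonneg add_nonneg_nonneg)
  have le: "norm (f s) \<le> exp (- b / h) * (K + b * norm z) + (- \<phi> s)" if b: "b > s" for b
  proof -
    have "norm (f b - f s) \<le> \<phi> b - \<phi> s"
    proof (rule differentiable_bound_general[OF b])
      show "continuous_on {s..b} f"
        unfolding f_def using s h by (intro continuous_intros T_cont_on) auto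
      show "continuous_on {s..b} \<phi>"
        unfolding \<phi>_def using h by (intro continuous_intros) auto
      fix r assume r: "s < r" "r < b"
      then have r0: "r > 0" using s by simp
      show "(f has_vector_derivative (- (1 / h)) *\<^sub>R exp (- r / h) *\<^sub>R (T r (w + h *\<^sub>R v) - u - (r - t) *\<^sub>R z)) (at r)"
      proof (rule has_vector_derivative_eq_rhs)
        have e: "((\<lambda>s. exp (- s / h)) has_field_derivative exp (- r / h) * (- 1 / h)) (at r)"
          using h by (auto intro!: derivative_eq_intros)
        have "((\<lambda>s. T s w - u - (s + h - t) *\<^sub>R z) has_vector_derivative (- T r v - z)) (at r)"
          using T_deriv_A[OF wv r0] by (auto intro!: derivative_eq_intros)
        from has_vector_derivative_scaleR[OF e this]
        show "(f has_vector_derivative exp (- r / h) *\<^sub>R (- T r v - z) + (exp (- r / h) * (- 1 / h)) *\<^sub>R (T r w - u - (r + h - t) *\<^sub>R z)) (at r)"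
          unfolding f_def .
        have *: "- T r v - z + (- 1 / h) *\<^sub>R (T r w - u - (r + h - t) *\<^sub>R z) = (- (1 / h)) *\<^sub>R (T r (w + h *\<^sub>R v) - u - (r - t) *\<^sub>R z)"
        proof -
          have "z = (1 / h) *\<^sub>R h *\<^sub>R z" "T r v = (1 / h) *\<^sub>R h *\<^sub>R T r v" using h by auto
          then show ?thesis
            using h by (simp add: blinfun.bilinear_simps algebra_simps)
        qed
        show "exp (- r / h) *\<^sub>R (- T r v - z) + (exp (- r / h) * (- 1 / h)) *\<^sub>R (T r w - u - (r + h - t) *\<^sub>R z)
          = (- (1 / h)) *\<^sub>R exp (- r / h) *\<^sub>R (T r (w + h *\<^sub>R v) - u - (r - t) *\<^sub>R z)"
          by (subst scaleR_left_commute, subst *[symmetric]) (simp only: scaleR_right_distrib scaleR_scaleR)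
      qed
      have "(\<phi> has_real_derivative (1 / h) * (exp (- r / h) * (c * (r - t)\<^sup>2 + d))) (at r)"
        unfolding \<phi>_def using h
        by (auto intro!: derivative_eq_intros simp: power2_eq_square field_simps)
      then show "(\<phi> has_vector_derivative (1 / h) * (exp (- r / h) * (c * (r - t)\<^sup>2 + d))) (at r)"
        by (simp add: has_real_derivative_iff_has_vector_derivative)
      show "norm ((- (1 / h)) *\<^sub>R exp (- r / h) *\<^sub>R (T r (w + h *\<^sub>R v) - u - (r - t) *\<^sub>R z)) \<le> (1 / h) * (exp (- r / h) * (c * (r - t)\<^sup>2 + d))"
        unfolding norm_scaleR using bnd[of r] r0 h
        by (auto intro!: divide_right_mono mult_left_mono)
    qed
    moreover have "norm (f b) \<le> exp (- b / h) * (K + b * norm z)"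
    proof -
      have b0: "b \<ge> 0" using b s by simp
      have "norm (T b w - u - (b + h - t) *\<^sub>R z) \<le> norm (T b w) + norm u + norm ((b + h - t) *\<^sub>R z)"
        by (meson add_mono_thms_linordered_semiring(3) norm_triangle_ineq4 order_trans)
      moreover have "norm ((b + h - t) *\<^sub>R z) \<le> (b + (h + \<bar>t\<bar>)) * norm z"
        using b0 h by (auto intro!: mult_right_mono)
      ultimately have "norm (T b w - u - (b + h - t) *\<^sub>R z) \<le> K + b * norm z"
        using T_norm[OF b0, of w] unfolding K_def by (simp add: algebra_simps)
      then show ?thesis unfolding f_def by simp
    qed
    ultimately show ?thesis
      using \<phi>0[of b] norm_triangle_ineq2[of "f s" "f b"] by (simp add: norm_minus_commute)
  qed
  have "norm (f s) \<le> 0 + (- \<phi> s)"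
  proof (rule tendsto_lowerbound)
    show "((\<lambda>b. exp (- b / h) * (K + b * norm z) + (- \<phi> s)) \<longlongrightarrow> 0 + (- \<phi> s)) at_top"
      by (intro tendsto_add exp_decay[OF h] tendsto_const)
    show "\<forall>\<^sub>F b in at_top. norm (f s) \<le> exp (- b / h) * (K + b * norm z) + (- \<phi> s)"
      using eventually_gt_at_top[of s] by eventually_elim (rule le)
  qed simp
  then show ?thesis unfolding f_def \<phi>_def by simp
qed

text \<open>The case of \<open>resolvent_compare\<close> with zero reference line and constant bound
  \<open>d\<close>. It yields injectivity of 1 + hA and the norm bound of its inverse.\<close>

lemma A_lower_bound:
  assumes "(w, v) \<in> A" "h > 0" shows "norm w \<le> M * norm (w + h *\<^sub>R v)"
  using resolvent_compare[OF assms, of 0 "M * norm (w + h *\<^sub>R v)" 0 0 0 0] T_norm M by simp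

text \<open>The truncated Laplace transforms \<open>w n\<close> satisfy (1 + hA) \<open>w n\<close>
  = h(x - \<open>y n\<close>) with \<open>y n\<close> tending to 0. The lower bound makes them
  Cauchy, and closedness makes the limit, divided by \<open>h\<close>, a preimage of
  \<open>x\<close>. Uniqueness of preimages gives linearity of \<open>B\<close>.\<close>

lemma resolvent_exists:
  assumes h: "h > 0"
  shows "\<exists>B::'a \<Rightarrow>\<^sub>L 'a. \<forall>x. (B x, (1 / h) *\<^sub>R (x - B x)) \<in> A"
proof -
  have ex: "\<exists>w. (w, (1 / h) *\<^sub>R (x - w)) \<in> A" for x
  proof -
    define w where "w n = integral {0..real n} (\<lambda>s. exp (- (1 / h) * s) *\<^sub>R T s x)" for n
    define y where "y n = exp (- (1 / h) * real n) *\<^sub>R T (real n) x" for n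
    have wA: "(w n, x - y n - (1 / h) *\<^sub>R w n) \<in> A" for n
      unfolding w_def y_def by (rule A_integral) simp
    have y: "y \<longlonglongrightarrow> 0"
    proof (rule Lim_null_comparison)
      show "\<forall>\<^sub>F n in sequentially. norm (y n) \<le> exp (- real n / h) * (M * norm x + real n * 0)"
        using T_norm[of "real _" x] by (simp add: y_def)
      show "(\<lambda>n. exp (- real n / h) * (M * norm x + real n * 0)) \<longlonglongrightarrow> 0"
        using filterlim_compose[OF exp_decay[OF h] filterlim_real_sequentially] .
    qed
    have wb: "norm (w n - w m) \<le> M * h * norm (y n - y m)" for n m
    proof -
      have "norm (w n + (-1) *\<^sub>R w m) \<le> M * norm ((w n + (-1) *\<^sub>R w m) + h *\<^sub>R ((x - y n - (1 / h) *\<^sub>R w n) + (-1) *\<^sub>R (x - y m - (1 / h) *\<^sub>R w m)))"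
        by (intro A_lower_bound A_add_scale wA h)
      also have "(w n + (-1) *\<^sub>R w m) + h *\<^sub>R ((x - y n - (1 / h) *\<^sub>R w n) + (-1) *\<^sub>R (x - y m - (1 / h) *\<^sub>R w m)) = h *\<^sub>R (y m - y n)"
        using h by (simp add: algebra_simps)
      finally show ?thesis using h by (simp add: norm_minus_commute)
    qed
    have "Cauchy w"
    proof (rule metric_CauchyI)
      fix e :: real assume e: "e > 0"
      have Mh: "M * h > 0" using M h by simp
      have "Cauchy y" using y by (meson LIMSEQ_imp_Cauchy)
      then obtain N where N: "\<And>m n. m \<ge> N \<Longrightarrow> n \<ge> N \<Longrightarrow> dist (y m) (y n) < e / (M * h)"
        unfolding Cauchy_def using e Mh by (metis divide_pos_pos)
      have "dist (w m) (w n) < e" if "m \<ge> N" "n \<ge> N" for m n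
        using wb[of m n] N[OF that] Mh by (simp add: dist_norm field_simps)
      then show "\<exists>N. \<forall>m\<ge>N. \<forall>n\<ge>N. dist (w m) (w n) < e" by blast
    qed
    then obtain w0 where w0: "w \<longlonglongrightarrow> w0" using Cauchy_convergent convergentD by blast
    have "(\<lambda>n. x - y n - (1 / h) *\<^sub>R w n) \<longlonglongrightarrow> x - 0 - (1 / h) *\<^sub>R w0"
      by (intro tendsto_intros y w0)
    then have "(w0, x - 0 - (1 / h) *\<^sub>R w0) \<in> A" using A_closed[OF wA w0] by blast
    from A_add_scale[OF A_0 this, of "1 / h"] show ?thesis
      by (intro exI[of _ "(1 / h) *\<^sub>R w0"]) simp
  qed
  then obtain B where B: "\<And>x. (B x, (1 / h) *\<^sub>R (x - B x)) \<in> A" by metis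
  have uniq: "w = B x" if "(w, v) \<in> A" "w + h *\<^sub>R v = x" for w v x
  proof -
    have v: "v = (1 / h) *\<^sub>R (x - w)" using that(2) h by auto
    have "norm (w + (-1) *\<^sub>R B x) \<le> M * norm ((w + (-1) *\<^sub>R B x) + h *\<^sub>R (v + (-1) *\<^sub>R (1 / h) *\<^sub>R (x - B x)))"
      by (intro A_lower_bound A_add_scale that B h)
    also have "(w + (-1) *\<^sub>R B x) + h *\<^sub>R (v + (-1) *\<^sub>R (1 / h) *\<^sub>R (x - B x)) = 0"
      unfolding v using h by (simp add: algebra_simps)
    finally show ?thesis by simp
  qed
  have "bounded_linear B"
  proof (rule bounded_linear_intro)
    have "B x + c *\<^sub>R B y = B (x + c *\<^sub>R y)" for c x y
      by (rule uniq[OF A_add_scale[OF B B]]) (use h in \<open>simp add: algebra_simps\<close>)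
    note * = this
    show "B (x + y) = B x + B y" for x y using *[of x 1 y] by simp
    have "B 0 = 0" using uniq[OF A_0] by simp
    then show "B (c *\<^sub>R x) = c *\<^sub>R B x" for c x using *[of 0 c x] by simp
    show "norm (B x) \<le> norm x * M" for x
      using A_lower_bound[OF B h, of x] h by (simp add: mult.commute)
  qed
  then show ?thesis using B by (intro exI[of _ "Blinfun B"]) (simp add: bounded_linear_Blinfun_apply)
qed

text \<open>For \<open>h > 0\<close> this is (1 + hA)^-1, described by A(Rx) = (x - Rx)/h; for other
  \<open>h\<close> it is arbitrary.\<close>

definition R :: "real \<Rightarrow> ('a \<Rightarrow>\<^sub>L 'a)"
  where "R h = (SOME B. \<forall>x. (blinfun_apply B x, (1 / h) *\<^sub>R (x - blinfun_apply B x)) \<in> A)"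

lemma R_A: "h > 0 \<Longrightarrow> (R h x, (1 / h) *\<^sub>R (x - R h x)) \<in> A"
  using someI_ex[OF resolvent_exists[of h]] unfolding R_def by blast

lemma R_unique:
  assumes "h > 0" "(w, v) \<in> A" shows "R h (w + h *\<^sub>R v) = w"
proof -
  let ?x = "w + h *\<^sub>R v"
  have "norm (w + (-1) *\<^sub>R R h ?x) \<le> M * norm ((w + (-1) *\<^sub>R R h ?x) + h *\<^sub>R (v + (-1) *\<^sub>R (1 / h) *\<^sub>R (?x - R h ?x)))"
    by (intro A_lower_bound A_add_scale assms R_A)
  also have "(w + (-1) *\<^sub>R R h ?x) + h *\<^sub>R (v + (-1) *\<^sub>R (1 / h) *\<^sub>R (?x - R h ?x)) = 0"
    using assms(1) by (simp add: algebra_simps)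
  finally show ?thesis by simp
qed

section \<open>The operators of the approximants expressed through resolvents\<close>

lemma bounded_op_graph: "bounded_op (op_graph B) = B"
  unfolding bounded_op_def
proof (rule the_equality)
  fix B' :: "'b \<Rightarrow>\<^sub>L 'b" assume "op_graph B' = op_graph B"
  then show "B' = B" unfolding op_graph_def by (intro blinfun_eqI) blast
qed simp

lemma bounded_op_affine:
  assumes "a > 0" "b > 0"
  shows "bounded_op ((op_affine a b A)\<inverse>) = (1 / a) *\<^sub>R R (b / a)"
proof -
  have h: "b / a > 0" using assms by simp
  have "(x, w) \<in> (op_affine a b A)\<inverse> \<longleftrightarrow> w = (1 / a) *\<^sub>R R (b / a) x" for x w
  proof
    assume "(x, w) \<in> (op_affine a b A)\<inverse>"
    then obtain v where v: "(w, v) \<in> A" "x = a *\<^sub>R w + b *\<^sub>R v" by (auto simp: op_affine_def)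
    have x: "x = a *\<^sub>R (w + (b / a) *\<^sub>R v)" using assms v(2) by (simp add: algebra_simps)
    show "w = (1 / a) *\<^sub>R R (b / a) x"
      unfolding x using R_unique[OF h v(1)] assms by (simp add: blinfun.bilinear_simps)
  next
    assume w: "w = (1 / a) *\<^sub>R R (b / a) x"
    let ?y = "R (b / a) x"
    have "(0 + (1 / a) *\<^sub>R ?y, 0 + (1 / a) *\<^sub>R (1 / (b / a)) *\<^sub>R (x - ?y)) \<in> A"
      by (intro A_add_scale A_0 R_A h)
    then have "(w, (1 / b) *\<^sub>R (x - ?y)) \<in> A" using assms w by simp
    moreover have "x = a *\<^sub>R w + b *\<^sub>R (1 / b) *\<^sub>R (x - ?y)" using assms w by simp
    ultimately show "(x, w) \<in> (op_affine a b A)\<inverse>" unfolding op_affine_def by blast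
  qed
  then have "(op_affine a b A)\<inverse> = op_graph ((1 / a) *\<^sub>R R (b / a))"
    unfolding op_graph_def by (auto simp: blinfun.scaleR_left)
  then show ?thesis by (simp add: bounded_op_graph)
qed

text \<open>Since A(n + A)^-1 = 1 - (1 + A/n)^-1, Yosida's exponential takes the Dunford-Segal form
  with a resolvent in place of e^(-A/n), so that \<open>poisson_error\<close> covers both.\<close>

lemma bounded_op_yosida:
  assumes "n > 0"
  shows "bounded_op ((op_affine n 1 A)\<inverse> O A) = id_blinfun - R (1 / n)"
proof -
  have "(x, z) \<in> (op_affine n 1 A)\<inverse> O A \<longleftrightarrow> z = x - R (1 / n) x" for x z
  proof
    assume "(x, z) \<in> (op_affine n 1 A)\<inverse> O A"
    then obtain w v where v: "(w, v) \<in> A" "x = n *\<^sub>R w + v" and z: "(w, z) \<in> A" by (auto simp: op_affine_def)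
    have "x = n *\<^sub>R (w + (1 / n) *\<^sub>R v)" using assms v(2) by (simp add: algebra_simps)
    then have "R (1 / n) x = n *\<^sub>R w"
      using R_unique[OF _ v(1), of "1 / n"] assms by (simp add: blinfun.bilinear_simps)
    then show "z = x - R (1 / n) x" using A_unique[OF z v(1)] v(2) by simp
  next
    assume z: "z = x - R (1 / n) x"
    have "(0 + (1 / n) *\<^sub>R R (1 / n) x, 0 + (1 / n) *\<^sub>R (1 / (1 / n)) *\<^sub>R (x - R (1 / n) x)) \<in> A"
      using assms by (intro A_add_scale A_0 R_A) simp
    then have "((1 / n) *\<^sub>R R (1 / n) x, z) \<in> A" using assms z by simp
    moreover have "x = n *\<^sub>R (1 / n) *\<^sub>R R (1 / n) x + 1 *\<^sub>R z" using assms z by simp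
    ultimately show "(x, z) \<in> (op_affine n 1 A)\<inverse> O A" unfolding op_affine_def by blast
  qed
  then have "(op_affine n 1 A)\<inverse> O A = op_graph (id_blinfun - R (1 / n))"
    unfolding op_graph_def by (auto simp: blinfun.bilinear_simps)
  then show ?thesis by (simp add: bounded_op_graph)
qed

end


section \<open>Exponentials of bounded operators\<close>

lemma blinfun_power_0 [simp]: "blinfun_power B 0 = id_blinfun"
  by (simp add: blinfun_power_def)

lemma blinfun_power_Suc [simp]: "blinfun_power B (Suc k) = B o\<^sub>L blinfun_power B k"
  by (simp add: blinfun_power_def)

lemma norm_blinfun_power: "norm (blinfun_power B k x) \<le> norm B ^ k * norm x"
proof (induction k)
  case (Suc k)
  have "norm (B (blinfun_power B k x)) \<le> norm B * norm (blinfun_power B k x)"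
    by (rule norm_blinfun)
  also have "\<dots> \<le> norm B * (norm B ^ k * norm x)" by (intro mult_left_mono Suc.IH) auto
  finally show ?case by (simp add: mult.assoc)
qed simp

lemma blinfun_exp_sums: "(\<lambda>k. (1 / fact k) *\<^sub>R blinfun_power B k x) sums blinfun_exp B x"
proof -
  have "summable (\<lambda>k. norm ((1 / fact k) *\<^sub>R blinfun_power B k))"
  proof (rule summable_comparison_test')
    show "summable (\<lambda>k. inverse (fact k) * norm B ^ k)" by (rule summable_exp)
    show "norm (norm ((1 / fact k) *\<^sub>R blinfun_power B k)) \<le> inverse (fact k) * norm B ^ k" if "k \<ge> 0" for k
    proof -
      have "norm (blinfun_power B k) \<le> norm B ^ k"
        by (rule norm_blinfun_bound) (auto intro: norm_blinfun_power)
      then show ?thesis by (simp add: inverse_eq_divide divide_right_mono)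
    qed
  qed
  then have "(\<lambda>k. (1 / fact k) *\<^sub>R blinfun_power B k) sums blinfun_exp B"
    unfolding blinfun_exp_def by (rule summable_sums[OF summable_norm_cancel])
  from bounded_linear.sums[OF blinfun.bounded_linear_left this, of x]
  show ?thesis by (simp add: blinfun.scaleR_left)
qed

section \<open>Exponentials as Poisson mixtures of operator powers\<close>

lemma blinfun_power_binomial:
  "blinfun_power (a *\<^sub>R id_blinfun + b *\<^sub>R V) k x
    = (\<Sum>j\<le>k. (real (k choose j) * a ^ (k - j) * b ^ j) *\<^sub>R blinfun_power V j x)"
proof (induction k)
  case (Suc k)
  let ?W = "\<lambda>j. blinfun_power V j x"
  let ?S = "\<Sum>j\<le>k. (real (k choose j) * a ^ (k - j) * b ^ j) *\<^sub>R ?W j"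
  have "(\<Sum>j\<le>Suc k. (real (Suc k choose j) * a ^ (Suc k - j) * b ^ j) *\<^sub>R ?W j)
    = (a ^ Suc k) *\<^sub>R ?W 0 + (\<Sum>j\<le>k. (real (Suc k choose Suc j) * a ^ (k - j) * b ^ Suc j) *\<^sub>R ?W (Suc j))"
    by (subst sum.atMost_Suc_shift) simp
  also have "\<dots> = (\<Sum>j\<le>k. (real (k choose j) * a ^ (k - j) * b ^ Suc j) *\<^sub>R ?W (Suc j))
    + ((a ^ Suc k) *\<^sub>R ?W 0 + (\<Sum>j\<le>k. (real (k choose Suc j) * a ^ (k - j) * b ^ Suc j) *\<^sub>R ?W (Suc j)))"
    by (simp add: distrib_right scaleR_add_left sum.distrib del: blinfun_power_Suc power_Suc)
  also have "(a ^ Suc k) *\<^sub>R ?W 0 + (\<Sum>j\<le>k. (real (k choose Suc j) * a ^ (k - j) * b ^ Suc j) *\<^sub>R ?W (Suc j))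
    = (\<Sum>j\<le>Suc k. (real (k choose j) * a ^ (Suc k - j) * b ^ j) *\<^sub>R ?W j)"
    by (subst sum.atMost_Suc_shift) simp
  also have "\<dots> = (\<Sum>j\<le>k. (real (k choose j) * a ^ (Suc k - j) * b ^ j) *\<^sub>R ?W j)"
    by simp
  also have "\<dots> = a *\<^sub>R ?S"
    unfolding scaleR_sum_right by (intro sum.cong) (auto simp: Suc_diff_le)
  also have "(\<Sum>j\<le>k. (real (k choose j) * a ^ (k - j) * b ^ Suc j) *\<^sub>R ?W (Suc j)) = b *\<^sub>R V ?S"
    unfolding blinfun.sum_right scaleR_sum_right by (intro sum.cong) (auto simp: blinfun.scaleR_right)
  finally have E: "(\<Sum>j\<le>Suc k. (real (Suc k choose j) * a ^ (Suc k - j) * b ^ j) *\<^sub>R ?W j)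
    = b *\<^sub>R V ?S + a *\<^sub>R ?S" .
  show ?case
    unfolding E unfolding blinfun_power_Suc blinfun_apply_blinfun_compose Suc.IH
    by (simp only: blinfun.add_left blinfun.scaleR_left id_blinfun.rep_eq add.commute)
qed simp

text \<open>Up to the factor \<open>exp (- \<tau>)\<close> these are the Poisson moments of order 0,
  1 and 2. Each comes from the lower ones by cancelling one factor \<open>j\<close> against the
  factorial and shifting the index.\<close>

lemma exp_moments:
  fixes \<tau> :: real
  shows "(\<lambda>j. \<tau> ^ j / fact j) sums exp \<tau>"
    and "(\<lambda>j. real j * (\<tau> ^ j / fact j)) sums (\<tau> * exp \<tau>)"
    and "(\<lambda>j. (real j)\<^sup>2 * (\<tau> ^ j / fact j)) sums ((\<tau>\<^sup>2 + \<tau>) * exp \<tau>)"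
proof -
  show 0: "(\<lambda>j. \<tau> ^ j / fact j) sums exp \<tau>"
    using exp_converges[of \<tau>] by (simp add: divide_inverse mult.commute)
  have shift: "real (Suc j) * (\<tau> ^ Suc j / fact (Suc j)) = \<tau> * (\<tau> ^ j / fact j)" for j
    by (simp add: field_simps del: of_nat_Suc)
  have "(\<lambda>j. real (Suc j) * (\<tau> ^ Suc j / fact (Suc j))) sums (\<tau> * exp \<tau>)"
    unfolding shift by (intro sums_mult 0)
  then show 1: "(\<lambda>j. real j * (\<tau> ^ j / fact j)) sums (\<tau> * exp \<tau>)"
    by (subst (asm) sums_Suc_iff) simp
  have shift2: "(real (Suc j))\<^sup>2 * (\<tau> ^ Suc j / fact (Suc j)) = \<tau> * (real j * (\<tau> ^ j / fact j) + \<tau> ^ j / fact j)" for j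
  proof -
    have "(real (Suc j))\<^sup>2 * (\<tau> ^ Suc j / fact (Suc j)) = real (Suc j) * (\<tau> * (\<tau> ^ j / fact j))"
      unfolding power2_eq_square mult.assoc shift ..
    also have "\<dots> = \<tau> * (real j * (\<tau> ^ j / fact j) + \<tau> ^ j / fact j)"
      by (simp add: algebra_simps add_divide_distrib)
    finally show ?thesis .
  qed
  have "(\<lambda>j. (real (Suc j))\<^sup>2 * (\<tau> ^ Suc j / fact (Suc j))) sums (\<tau> * (\<tau> * exp \<tau> + exp \<tau>))"
    unfolding shift2 by (intro sums_mult sums_add 0 1)
  then show "(\<lambda>j. (real j)\<^sup>2 * (\<tau> ^ j / fact j)) sums ((\<tau>\<^sup>2 + \<tau>) * exp \<tau>)"
    by (subst (asm) sums_Suc_iff) (simp add: power2_eq_square algebra_simps)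
qed

text \<open>The scalar factor e^(-\<tau>) splits off since the identity commutes with
  \<open>V\<close>. After applying \<open>f\<close> this is a Cauchy product of absolutely
  convergent scalar series.\<close>

lemma poisson_mixture:
  fixes f :: "'a::complex_banach \<Rightarrow> real"
  assumes f: "bounded_linear f"
  shows "(\<lambda>j. exp (- \<tau>) * (\<tau> ^ j / fact j) * f (blinfun_power V j x))
    sums f (blinfun_exp (- \<tau> *\<^sub>R (id_blinfun - V)) x)"
proof -
  interpret f: bounded_linear f by (rule f)
  obtain K where K: "\<And>x. norm (f x) \<le> norm x * K" "K \<ge> 0" using f.nonneg_bounded by blast
  define a where "a = (\<lambda>i. (- \<tau>) ^ i / fact i)"
  define b where "b = (\<lambda>j. \<tau> ^ j / fact j * f (blinfun_power V j x))"
  define B where "B = - \<tau> *\<^sub>R (id_blinfun - V)"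
  have B: "B = (- \<tau>) *\<^sub>R id_blinfun + \<tau> *\<^sub>R V" unfolding B_def by (simp add: algebra_simps)
  have a: "summable (\<lambda>i. norm (a i))"
    using exp_moments(1)[of "\<bar>\<tau>\<bar>"] unfolding a_def by (simp add: sums_iff power_abs)
  have b: "summable (\<lambda>j. norm (b j))"
  proof (rule summable_comparison_test')
    show "summable (\<lambda>j. (\<bar>\<tau>\<bar> * norm V) ^ j / fact j * (norm x * K))"
      using exp_moments(1)[of "\<bar>\<tau>\<bar> * norm V"] by (intro summable_mult2) (simp add: sums_iff)
    fix j :: nat
    have "\<bar>f (blinfun_power V j x)\<bar> \<le> norm (blinfun_power V j x) * K"
      using K(1)[of "blinfun_power V j x"] by simp
    also have "\<dots> \<le> (norm V ^ j * norm x) * K"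
      by (intro mult_right_mono norm_blinfun_power K(2))
    finally have "\<bar>\<tau>\<bar> ^ j / fact j * \<bar>f (blinfun_power V j x)\<bar> \<le> \<bar>\<tau>\<bar> ^ j / fact j * ((norm V ^ j * norm x) * K)"
      by (intro mult_left_mono) auto
    then show "norm (norm (b j)) \<le> (\<bar>\<tau>\<bar> * norm V) ^ j / fact j * (norm x * K)"
      unfolding b_def by (simp add: abs_mult power_abs power_mult_distrib mult_ac)
  qed
  \<comment> \<open>By the binomial theorem for \<tau>V - \<tau>, the Cauchy coefficient of index
    \<open>k\<close> is the corresponding term of the exponential series.\<close>
  have "(\<Sum>i\<le>k. a i * b (k - i)) = f ((1 / fact k) *\<^sub>R blinfun_power B k x)" for k
  proof -
    have "(\<Sum>i\<le>k. a i * b (k - i)) = (\<Sum>j\<le>k. a (k - j) * b j)"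
      by (rule sum.reindex_bij_witness[of _ "\<lambda>j. k - j" "\<lambda>i. k - i"]) auto
    also have "\<dots> = (\<Sum>j\<le>k. (1 / fact k) * ((real (k choose j) * (- \<tau>) ^ (k - j) * \<tau> ^ j) * f (blinfun_power V j x)))"
      unfolding a_def b_def
      by (intro sum.cong) (auto simp: binomial_fact)
    finally show ?thesis
      unfolding B blinfun_power_binomial by (simp add: f.sum f.scaleR sum_distrib_left)
  qed
  then have 1: "(\<lambda>k. f ((1 / fact k) *\<^sub>R blinfun_power B k x)) sums (suminf a * suminf b)"
    using Cauchy_product_sums[OF a b] by simp
  have "f (blinfun_exp B x) = suminf a * suminf b"
    by (rule sums_unique2[OF f.sums[OF blinfun_exp_sums[of B x]] 1])
  moreover have "suminf a = exp (- \<tau>)"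
    unfolding a_def by (rule sums_unique[OF exp_moments(1), symmetric])
  moreover have "(\<lambda>j. exp (- \<tau>) * b j) sums (exp (- \<tau>) * suminf b)"
    by (rule sums_mult[OF summable_sums[OF summable_norm_cancel[OF b]]])
  ultimately show ?thesis unfolding b_def B_def by (simp add: mult.assoc)
qed

text \<open>For \<open>j\<close> Poisson with parameter \<open>n * t\<close>, the time
  \<open>j / n\<close> has mean \<open>t\<close>, so the term with \<open>v\<close> averages to
  zero. Its variance is \<open>t / n\<close>, and \<open>real j / n\<^sup>2\<close> has mean
  \<open>t / n\<close> as well; together they give the factor 2.\<close>

lemma poisson_error:
  fixes V :: "'a::complex_banach \<Rightarrow>\<^sub>L 'a" and n t :: real
  assumes n: "n > 0"
    and bnd: "\<And>j. norm (blinfun_power V j x - u - (real j / n - t) *\<^sub>R v) \<le> c * ((real j / n - t)\<^sup>2 + real j / n\<^sup>2)"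
    and t: "t \<ge> 0"
  shows "norm (blinfun_exp (- (n * t) *\<^sub>R (id_blinfun - V)) x - u) \<le> 2 * c * t / n"
proof (rule norm_le_functionals)
  fix f :: "'a \<Rightarrow> real" assume f: "bounded_linear f" and fb: "\<And>y. \<bar>f y\<bar> \<le> norm y"
  interpret f: bounded_linear f by (rule f)
  define \<tau> where "\<tau> = n * t"
  define p where "p = (\<lambda>j. exp (- \<tau>) * (\<tau> ^ j / fact j))"
  define E where "E = blinfun_exp (- \<tau> *\<^sub>R (id_blinfun - V)) x"
  define r where "r = (\<lambda>j. blinfun_power V j x - u - (real j / n - t) *\<^sub>R v)"
  define q where "q = (\<lambda>j. c * ((real j / n - t)\<^sup>2 + real j / n\<^sup>2))"
  have p0: "p j \<ge> 0" for j using n t by (simp add: p_def \<tau>_def)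
  have e: "exp (- \<tau>) * (y * exp \<tau>) = y" for y by (simp add: exp_minus)
  have p1: "p sums 1"
    using sums_mult[OF exp_moments(1)[of \<tau>], of "exp (- \<tau>)"] by (simp add: p_def exp_minus)
  have p2: "(\<lambda>j. real j * p j) sums \<tau>"
    using sums_mult[OF exp_moments(2)[of \<tau>], of "exp (- \<tau>)"] unfolding e p_def
    by (simp only: mult.left_commute)
  have p3: "(\<lambda>j. (real j)\<^sup>2 * p j) sums (\<tau>\<^sup>2 + \<tau>)"
    using sums_mult[OF exp_moments(3)[of \<tau>], of "exp (- \<tau>)"] unfolding e p_def
    by (simp only: mult.left_commute)
  have p4: "(\<lambda>j. p j * f (blinfun_power V j x)) sums f E"
    unfolding p_def E_def by (rule poisson_mixture[OF f])
  have "(\<lambda>j. p j * f (blinfun_power V j x) - (f u * p j + f v * ((1 / n) * (real j * p j) - t * p j)))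
    sums (f E - (f u * 1 + f v * ((1 / n) * \<tau> - t * 1)))"
    by (intro sums_diff sums_add sums_mult p1 p2 p4)
  moreover have "p j * f (blinfun_power V j x) - (f u * p j + f v * ((1 / n) * (real j * p j) - t * p j))
    = p j * f (r j)" for j
  proof -
    have "f (r j) = f (blinfun_power V j x) - f u - (real j / n - t) * f v"
      unfolding r_def f.diff f.scaleR by simp
    then show ?thesis by (simp only:) (simp add: algebra_simps)
  qed
  moreover have "f E - (f u * 1 + f v * ((1 / n) * \<tau> - t * 1)) = f (E - u)"
    using n by (simp add: \<tau>_def f.diff)
  ultimately have S: "(\<lambda>j. p j * f (r j)) sums f (E - u)"
    by simp
  \<comment> \<open>The quadratic bound is expanded in powers of \<open>j\<close> so that the three
    moments determine its mean.\<close>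
  have "(\<lambda>j. c * ((1 / n\<^sup>2) * ((real j)\<^sup>2 * p j) + (1 / n\<^sup>2 - 2 * t / n) * (real j * p j) + t\<^sup>2 * p j))
     sums (c * ((1 / n\<^sup>2) * (\<tau>\<^sup>2 + \<tau>) + (1 / n\<^sup>2 - 2 * t / n) * \<tau> + t\<^sup>2 * 1))"
    by (intro sums_mult sums_add p1 p2 p3)
  moreover have "c * ((1 / n\<^sup>2) * ((real j)\<^sup>2 * p j) + (1 / n\<^sup>2 - 2 * t / n) * (real j * p j) + t\<^sup>2 * p j)
    = p j * q j" for j
  proof -
    have "(real j / n - t)\<^sup>2 = (1 / n\<^sup>2) * (real j)\<^sup>2 - 2 * t / n * real j + t\<^sup>2"
      by (simp add: power2_diff power_divide)
    then show ?thesis unfolding q_def by (simp only:) (simp add: algebra_simps)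
  qed
  moreover have "c * ((1 / n\<^sup>2) * (\<tau>\<^sup>2 + \<tau>) + (1 / n\<^sup>2 - 2 * t / n) * \<tau> + t\<^sup>2 * 1) = 2 * c * t / n"
    using n unfolding \<tau>_def by (simp add: power2_eq_square field_simps)
  ultimately have B: "(\<lambda>j. p j * q j) sums (2 * c * t / n)" by simp
  have le: "\<bar>p j * f (r j)\<bar> \<le> p j * q j" for j
    unfolding abs_mult using p0[of j] bnd[of j] fb[of "r j"]
    by (auto intro!: mult_left_mono simp: q_def r_def)
  have "f (E - u) \<le> 2 * c * t / n"
    by (rule sums_le[OF _ S B]) (use le in \<open>auto simp: abs_le_iff\<close>)
  moreover have "- f (E - u) \<le> 2 * c * t / n"
    by (rule sums_le[OF _ sums_minus[OF S] B]) (use le in \<open>auto simp: abs_le_iff\<close>)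
  ultimately show "\<bar>f (blinfun_exp (- (n * t) *\<^sub>R (id_blinfun - V)) x - u)\<bar> \<le> 2 * c * t / n"
    unfolding E_def \<tau>_def by simp
qed


section \<open>Convergence rates at the endpoints\<close>

context analytic_semigroup
begin

text \<open>\<open>G\<close> is the norm of \<open>t\<^bsup>\<alpha> - 1\<^esup> A\<^bsup>\<alpha>\<^esup> x\<close> for \<open>\<alpha> = 0\<close> or \<open>\<alpha> = 1\<close>.\<close>

definition endpoint_bound :: "real \<Rightarrow> 'a \<Rightarrow> real \<Rightarrow> bool"
  where "endpoint_bound t x G \<longleftrightarrow> G = norm x / t \<or> (\<exists>y. (x, y) \<in> A \<and> G = norm y)"

text \<open>For \<open>s \<ge> t / 2\<close> analyticity makes the derivative of the orbit
  Lipschitz. For \<open>s < t / 2\<close> the distance to \<open>t\<close> is of order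
  \<open>t\<close>, so separate bounds of the increment and of the linear term suffice.\<close>

lemma second_order:
  assumes t: "t > 0" and G: "endpoint_bound t x G"
  shows "\<exists>v. \<forall>s\<ge>0. norm (T s x - T t x - (s - t) *\<^sub>R v) \<le> 32 * M\<^sup>2 * M1\<^sup>2 / t * G * (s - t)\<^sup>2"
proof -
  \<comment> \<open>For \<open>s \<ge> t / 2\<close> there remains
    \<open>s - \<delta> \<ge> \<delta>\<close>: analyticity can be used once up to time \<delta> and
    once more afterwards, each time at the cost \<open>4 * M1 / t\<close>. In the domain case the
    first use is replaced by boundedness.\<close>
  define \<delta> where "\<delta> = t / 4"
  have \<delta>: "\<delta> > 0" using t by (simp add: \<delta>_def)
  have G0: "G \<ge> 0" using G t by (auto simp: endpoint_bound_def)
  have MM: "M \<le> M * M1" "1 \<le> M * M1" "M * M1 \<ge> 0"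
    using M M1 mult_mono[of 1 M 1 M1] mult_mono[of M M 1 M1] by auto
  obtain z where z: "((\<lambda>r. T r x) has_vector_derivative z) (at \<delta>)" and zb: "norm z \<le> 4 * (M * M1) * G"
  proof (cases "G = norm x / t")
    case True
    obtain z where z: "((\<lambda>r. T r x) has_vector_derivative z) (at \<delta>)" "norm z \<le> M1 / \<delta> * norm x"
      using T_deriv[OF \<delta>] by blast
    have "M1 / \<delta> * norm x = 4 * (1 * M1) * G" unfolding True \<delta>_def by simp
    also have "\<dots> \<le> 4 * (M * M1) * G" using G0 M M1 by (intro mult_right_mono mult_left_mono) auto
    finally show ?thesis by (intro that[OF z(1)] order_trans[OF z(2)])
  next
    case False
    then obtain y where y: "(x, y) \<in> A" "G = norm y" using G unfolding endpoint_bound_def by blast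
    have "norm (- T \<delta> y) \<le> M * G" using T_norm[of \<delta> y] \<delta> y(2) by simp
    also have "\<dots> \<le> 4 * (M * M1) * G" using MM by (intro mult_right_mono G0) linarith
    finally show ?thesis by (rule that[OF T_deriv_A[OF y(1) \<delta>]])
  qed
  have low: "norm (T s x - T t x) \<le> 4 * (M * M1) * G * \<bar>s - t\<bar>" if s: "0 \<le> s" "s < t / 2" for s
  proof (cases "G = norm x / t")
    case True
    have "norm (T s x - T t x) \<le> M * norm x + M * norm x"
      using norm_triangle_ineq4[of "T s x" "T t x"] T_norm[of s x] T_norm[of t x] s t by linarith
    also have "\<dots> = 4 * M * G * (t / 2)" unfolding True using t by simp
    also have "\<dots> \<le> 4 * (M * M1) * G * \<bar>s - t\<bar>"
      using s t MM G0 M by (intro mult_mono mult_nonneg_nonneg) auto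
    finally show ?thesis .
  next
    case False
    then obtain y where y: "(x, y) \<in> A" "G = norm y" using G unfolding endpoint_bound_def by blast
    have "norm (T t x - T s x + (t - s) *\<^sub>R 0) \<le> M * G * (t - s)"
      using T_norm[of _ y] s t y(2) by (intro T_lipschitz_A[OF y(1)]) auto
    also have "\<dots> \<le> 4 * (M * M1) * G * \<bar>s - t\<bar>"
      using s t MM G0 M by (intro mult_mono mult_nonneg_nonneg) auto
    finally show ?thesis by (simp add: norm_minus_commute)
  qed
  \<comment> \<open>By the semigroup law this is the derivative of the orbit at
    \<open>t\<close>.\<close>
  define v where "v = T (t - \<delta>) z"
  have v: "norm v \<le> M * norm z" unfolding v_def using t by (intro T_norm) (simp add: \<delta>_def)
  have zA: "(T \<delta> x, - z) \<in> A" by (rule T_in_A[OF \<delta> z])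
  have shift: "T (s - \<delta>) (T \<delta> x) = T s x" if "s \<ge> \<delta>" for s
    using T_add[of "s - \<delta>" \<delta> x] that \<delta> by simp
  have high: "norm (T s x - T t x - (s - t) *\<^sub>R v) \<le> M1 / \<delta> * norm z * (s - t)\<^sup>2" if s: "t / 2 \<le> s" for s
  proof -
    let ?K = "M1 / \<delta> * norm z * \<bar>s - t\<bar>"
    have sd: "\<delta> \<le> s" "\<delta> \<le> t" using s t unfolding \<delta>_def by auto
    have K: "norm (T r (- z) - (- v)) \<le> ?K" if r: "\<delta> \<le> r" "\<bar>r - (t - \<delta>)\<bar> \<le> \<bar>s - t\<bar>" for r
    proof -
      have "norm (T r z - T (t - \<delta>) z) \<le> M1 / \<delta> * norm z * \<bar>r - (t - \<delta>)\<bar>"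
        using r t by (intro T_lipschitz \<delta>) (auto simp: \<delta>_def)
      also have "\<dots> \<le> ?K" using r \<delta> M1 by (intro mult_left_mono mult_nonneg_nonneg) auto
      finally show ?thesis unfolding v_def by (simp add: blinfun.bilinear_simps norm_minus_commute)
    qed
    have "norm (T s x - T t x - (s - t) *\<^sub>R v) \<le> ?K * \<bar>s - t\<bar>"
    proof (cases "t \<le> s")
      case True
      have "norm (T (s - \<delta>) (T \<delta> x) - T (t - \<delta>) (T \<delta> x) + ((s - \<delta>) - (t - \<delta>)) *\<^sub>R (- v)) \<le> ?K * ((s - \<delta>) - (t - \<delta>))"
        using True t by (intro T_lipschitz_A[OF zA] K) (auto simp: \<delta>_def)
      then show ?thesis unfolding shift[OF sd(1)] shift[OF sd(2)] using True by simp
    next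
      case False
      have "norm (T (t - \<delta>) (T \<delta> x) - T (s - \<delta>) (T \<delta> x) + ((t - \<delta>) - (s - \<delta>)) *\<^sub>R (- v)) \<le> ?K * ((t - \<delta>) - (s - \<delta>))"
        using False s t by (intro T_lipschitz_A[OF zA] K) (auto simp: \<delta>_def)
      then have "norm (T t x - T s x + (t - s) *\<^sub>R (- v)) \<le> ?K * \<bar>s - t\<bar>"
        unfolding shift[OF sd(1)] shift[OF sd(2)] using False by simp
      moreover have "T t x - T s x + (t - s) *\<^sub>R (- v) = - (T s x - T t x - (s - t) *\<^sub>R v)"
        by (simp add: algebra_simps)
      ultimately show ?thesis by (metis norm_minus_cancel)
    qed
    then show ?thesis by (simp add: power2_eq_square mult.assoc flip: abs_mult)
  qed
  \<comment> \<open>Late times give the constant \<open>16 * M * M1\<^sup>2\<close> and early times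
    \<open>16 * M\<^sup>2 * M1\<^sup>2\<close>; the common constant 32 covers both.\<close>
  have fin: "norm (T s x - T t x - (s - t) *\<^sub>R v) \<le> 32 * M\<^sup>2 * M1\<^sup>2 / t * G * (s - t)\<^sup>2" if s: "s \<ge> 0" for s
  proof (cases "t / 2 \<le> s")
    case True
    have "M1 / \<delta> * norm z \<le> M1 / \<delta> * (4 * (M * M1) * G)"
      using \<delta> M1 zb by (intro mult_left_mono) auto
    also have "\<dots> = 16 * (M * 1) * M1\<^sup>2 / t * G" by (simp add: \<delta>_def power2_eq_square)
    also have "\<dots> \<le> 32 * (M * M) * M1\<^sup>2 / t * G"
      using M t G0 by (intro mult_right_mono divide_right_mono mult_mono) auto
    finally have "M1 / \<delta> * norm z * (s - t)\<^sup>2 \<le> 32 * (M * M) * M1\<^sup>2 / t * G * (s - t)\<^sup>2"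
      by (rule mult_right_mono) simp
    then show ?thesis using high[OF True] by (simp add: power2_eq_square)
  next
    case False
    have "norm (T s x - T t x - (s - t) *\<^sub>R v) \<le> norm (T s x - T t x) + norm ((s - t) *\<^sub>R v)"
      by (rule norm_triangle_ineq4)
    also have "\<dots> \<le> 4 * (M * M1) * G * \<bar>s - t\<bar> + \<bar>s - t\<bar> * (M * (4 * (M * M1) * G))"
    proof (rule add_mono)
      show "norm (T s x - T t x) \<le> 4 * (M * M1) * G * \<bar>s - t\<bar>" using low[OF s] False by simp
      have "norm v \<le> M * (4 * (M * M1) * G)"
        using v mult_left_mono[OF zb, of M] M by linarith
      then show "norm ((s - t) *\<^sub>R v) \<le> \<bar>s - t\<bar> * (M * (4 * (M * M1) * G))"
        unfolding norm_scaleR by (intro mult_left_mono) auto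
    qed
    also have "\<dots> = (4 * M * (1 + M)) * M1 * G * \<bar>s - t\<bar>" by (simp add: algebra_simps)
    also have "\<dots> \<le> (4 * M * (M + M)) * (M1 * M1) * G * (2 * (s - t)\<^sup>2 / t)"
    proof (intro mult_mono mult_nonneg_nonneg)
      \<comment> \<open>As \<open>s < t / 2\<close>, the distance from \<open>s\<close> to
        \<open>t\<close> exceeds \<open>t / 2\<close>, which turns the linear bound into a quadratic
        one.\<close>
      have "\<bar>s - t\<bar> * t \<le> \<bar>s - t\<bar> * (2 * \<bar>s - t\<bar>)" using False s t by (intro mult_left_mono) auto
      then show "\<bar>s - t\<bar> \<le> 2 * (s - t)\<^sup>2 / t" using t
        by (simp add: field_simps power2_eq_square flip: abs_mult)
    qed (use M M1 G0 in auto)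
    also have "\<dots> = 16 * M\<^sup>2 * M1\<^sup>2 / t * G * (s - t)\<^sup>2" by (simp add: power2_eq_square)
    also have "\<dots> \<le> 32 * M\<^sup>2 * M1\<^sup>2 / t * G * (s - t)\<^sup>2"
      using t G0 by (intro mult_right_mono divide_right_mono) auto
    finally show ?thesis .
  qed
  then show ?thesis by blast
qed

text \<open>Each resolvent averages over an exponential time with mean \<open>h\<close> and variance
  \<open>h\<^sup>2\<close>; after \<open>k\<close> of them the time has mean \<open>s + k h\<close>
  and variance \<open>k h\<^sup>2\<close>.\<close>

lemma R_power_compare:
  assumes h: "h > 0" and c: "c \<ge> 0"
    and bnd: "\<And>s. s \<ge> 0 \<Longrightarrow> norm (T s x - u - (s - t) *\<^sub>R v) \<le> c * (s - t)\<^sup>2"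
    and s: "s \<ge> 0"
  shows "norm (T s (blinfun_power (R h) k x) - u - (s + real k * h - t) *\<^sub>R v) \<le> c * ((s + real k * h - t)\<^sup>2 + real k * h\<^sup>2)"
  using s
proof (induction k arbitrary: s)
  case 0
  then show ?case using bnd[of s] by simp
next
  case (Suc k)
  let ?y = "blinfun_power (R h) k x"
  \<comment> \<open>The earlier steps move the target time from \<open>t\<close> to
    \<open>t - k h\<close>; their variance is carried in the constant \<open>d\<close> of
    \<open>resolvent_compare\<close>.\<close>
  have "norm (T s (R h ?y) - u - (s + h - (t - real k * h)) *\<^sub>R v) \<le> c * ((s + h - (t - real k * h))\<^sup>2 + h\<^sup>2) + c * (real k * h\<^sup>2)"
  proof (rule resolvent_compare[OF R_A[OF h] h c])
    fix r :: real assume "r \<ge> 0"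
    from Suc.IH[OF this]
    show "norm (T r (R h ?y + h *\<^sub>R (1 / h) *\<^sub>R (?y - R h ?y)) - u - (r - (t - real k * h)) *\<^sub>R v) \<le> c * (r - (t - real k * h))\<^sup>2 + c * (real k * h\<^sup>2)"
      using h by (simp add: algebra_simps)
  qed (use Suc c in auto)
  moreover have "s + h - (t - real k * h) = s + real (Suc k) * h - t" by (simp add: algebra_simps)
  ultimately show ?case by (simp add: algebra_simps)
qed

section \<open>Errors of the three approximants\<close>

lemma endpoint_nonneg: "t > 0 \<Longrightarrow> endpoint_bound t x G \<Longrightarrow> G \<ge> 0"
  by (auto simp: endpoint_bound_def)

text \<open>The \<open>n\<close> resolvent steps of length \<open>t / n\<close> have total mean time
  exactly \<open>t\<close>: the linear term vanishes and the variance \<open>t\<^sup>2 / n\<close>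
  remains.\<close>

lemma euler_error:
  assumes t: "t > 0" and n: "n \<ge> 1" and G: "endpoint_bound t x G"
  shows "norm (T t x - euler_approx A n t x) \<le> 32 * M\<^sup>2 * M1\<^sup>2 * (t / real n) * G"
proof -
  let ?c = "32 * M\<^sup>2 * M1\<^sup>2 / t * G"
  obtain v where v: "\<And>s. s \<ge> 0 \<Longrightarrow> norm (T s x - T t x - (s - t) *\<^sub>R v) \<le> ?c * (s - t)\<^sup>2"
    using second_order[OF t G] by blast
  have h: "t / real n > 0" using t n by simp
  have c: "?c \<ge> 0" using endpoint_nonneg[OF t G] t by simp
  have "norm (T 0 (blinfun_power (R (t / real n)) n x) - T t x - (0 + real n * (t / real n) - t) *\<^sub>R v)
    \<le> ?c * ((0 + real n * (t / real n) - t)\<^sup>2 + real n * (t / real n)\<^sup>2)"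
    by (rule R_power_compare[OF h c v]) auto
  also have "\<dots> = 32 * M\<^sup>2 * M1\<^sup>2 * (t / real n) * G"
    using t n by (simp add: power2_eq_square)
  finally show ?thesis
    using n t bounded_op_affine[OF _ h, of 1] unfolding euler_approx_def
    by (simp add: norm_minus_commute)
qed

text \<open>Given \<open>j\<close>, the \<open>j\<close> resolvents of step \<open>1 / n\<close>
  have mean time \<open>j / n\<close> and variance \<open>j / n\<^sup>2\<close>, the form that
  \<open>poisson_error\<close> averages.\<close>

lemma yosida_error:
  assumes t: "t > 0" and n: "n \<ge> 1" and G: "endpoint_bound t x G"
  shows "norm (T t x - yosida_approx A n t x) \<le> 64 * M\<^sup>2 * M1\<^sup>2 * (1 / real n) * G"
proof -
  let ?c = "32 * M\<^sup>2 * M1\<^sup>2 / t * G"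
  obtain v where v: "\<And>s. s \<ge> 0 \<Longrightarrow> norm (T s x - T t x - (s - t) *\<^sub>R v) \<le> ?c * (s - t)\<^sup>2"
    using second_order[OF t G] by blast
  have h: "1 / real n > 0" using n by simp
  have c: "?c \<ge> 0" using endpoint_nonneg[OF t G] t by simp
  have "norm (blinfun_exp (- (real n * t) *\<^sub>R (id_blinfun - R (1 / real n))) x - T t x) \<le> 2 * ?c * t / real n"
  proof (rule poisson_error)
    fix j
    have "norm (T 0 (blinfun_power (R (1 / real n)) j x) - T t x - (0 + real j * (1 / real n) - t) *\<^sub>R v)
      \<le> ?c * ((0 + real j * (1 / real n) - t)\<^sup>2 + real j * (1 / real n)\<^sup>2)"
      by (rule R_power_compare[OF h c v]) auto
    then show "norm (blinfun_power (R (1 / real n)) j x - T t x - (real j / real n - t) *\<^sub>R v)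
      \<le> ?c * ((real j / real n - t)\<^sup>2 + real j / (real n)\<^sup>2)"
      by (simp add: power_divide)
  qed (use n t in auto)
  also have "2 * ?c * t / real n = 64 * M\<^sup>2 * M1\<^sup>2 * (1 / real n) * G" using t by simp
  finally show ?thesis
    using n bounded_op_yosida[of "real n"] unfolding yosida_approx_def
    by (simp add: norm_minus_commute)
qed

lemma T_power: "h \<ge> 0 \<Longrightarrow> blinfun_power (T h) k x = T (real k * h) x"
proof (induction k)
  case (Suc k)
  then show ?case using T_add[of h "real k * h" x] by (simp add: distrib_right)
qed simp

lemma dunford_segal_error:
  assumes t: "t > 0" and n: "n \<ge> 1" and G: "endpoint_bound t x G"
  shows "norm (T t x - dunford_segal_approx T n t x) \<le> 64 * M\<^sup>2 * M1\<^sup>2 * (1 / real n) * G"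
proof -
  let ?c = "32 * M\<^sup>2 * M1\<^sup>2 / t * G"
  obtain v where v: "\<And>s. s \<ge> 0 \<Longrightarrow> norm (T s x - T t x - (s - t) *\<^sub>R v) \<le> ?c * (s - t)\<^sup>2"
    using second_order[OF t G] by blast
  have c: "?c \<ge> 0" using endpoint_nonneg[OF t G] t by simp
  have "norm (blinfun_exp (- (real n * t) *\<^sub>R (id_blinfun - T (1 / real n))) x - T t x) \<le> 2 * ?c * t / real n"
  proof (rule poisson_error)
    fix j
    have "norm (T (real j / real n) x - T t x - (real j / real n - t) *\<^sub>R v) \<le> ?c * (real j / real n - t)\<^sup>2"
      by (rule v) simp
    \<comment> \<open>A power of \<open>T (1 / n)\<close> is evaluated at a fixed time; the
      nonnegative summand only adapts the bound to \<open>poisson_error\<close>.\<close>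
    also have "\<dots> \<le> ?c * ((real j / real n - t)\<^sup>2 + real j / (real n)\<^sup>2)"
      by (intro mult_left_mono c) simp
    finally show "norm (blinfun_power (T (1 / real n)) j x - T t x - (real j / real n - t) *\<^sub>R v)
      \<le> ?c * ((real j / real n - t)\<^sup>2 + real j / (real n)\<^sup>2)"
      by (simp add: T_power)
  qed (use n t in auto)
  also have "2 * ?c * t / real n = 64 * M\<^sup>2 * M1\<^sup>2 * (1 / real n) * G" using t by simp
  finally show ?thesis
    unfolding dunford_segal_approx_def by (simp add: norm_minus_commute)
qed

end


section \<open>Abel inversion\<close>

text \<open>The truncated power is total on the line, so convolutions become integrals over all
  reals and substitutions leave no limits to track.\<close>

definition tpow :: "real \<Rightarrow> real \<Rightarrow> real"
  where "tpow a s = indicator {0<..} s * s powr a"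

lemma tpow_measurable [measurable]: "tpow a \<in> borel_measurable borel"
  unfolding tpow_def by measurable

lemma tpow_nonneg [simp]: "tpow a s \<ge> 0"
  by (simp add: tpow_def)

lemma tpow_mult: "c > 0 \<Longrightarrow> tpow a (c * s) = c powr a * tpow a s"
  by (auto simp: tpow_def indicator_def powr_mult zero_less_mult_iff)

text \<open>Transfers Gamma, Beta and power integrals from the gauge integral to the Lebesgue
  setting, where Fubini is applied.\<close>

lemma has_bochner_integral_nonneg_has_integral:
  fixes f :: "real \<Rightarrow> real"
  assumes [measurable]: "f \<in> borel_measurable borel" "S \<in> sets borel"
    and "\<And>x. x \<in> S \<Longrightarrow> 0 \<le> f x" and I: "(f has_integral I) S"
  shows "has_bochner_integral lborel (\<lambda>x. indicator S x * f x) I"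
proof (rule has_bochner_integral_nn_integral)
  show "0 \<le> I" using has_integral_nonneg[OF I] assms(3) by blast
  show "(\<integral>\<^sup>+x. ennreal (indicator S x * f x) \<partial>lborel) = ennreal I"
    by (rule nn_integral_has_integral_lebesgue) (use assms in auto)
  show "AE x in lborel. 0 \<le> indicator S x * f x"
    using assms(3) by (intro AE_I2) (auto simp: indicator_def)
qed measurable

lemma tpow_exp_integral:
  assumes "a > 0" "c > 0"
  shows "has_bochner_integral lborel (\<lambda>s. tpow (a - 1) s * exp (- s * c)) (Gamma a * c powr (- a))"
proof -
  have "has_bochner_integral lborel (\<lambda>s. indicator {0..} s * (s powr (a - 1) / exp s)) (Gamma a)"
    by (rule has_bochner_integral_nonneg_has_integral[OF _ _ _ Gamma_integral_real[OF assms(1)]]) auto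
  moreover have "indicator {0..} s * (s powr (a - 1) / exp s) = tpow (a - 1) s * exp (- s)" for s :: real
    by (auto simp: tpow_def indicator_def exp_minus field_simps)
  ultimately have "has_bochner_integral lborel (\<lambda>s. tpow (a - 1) s * exp (- s)) (Gamma a)"
    by simp
  from lborel_has_bochner_integral_real_affine_iff[THEN iffD1, OF _ this, of c 0]
  have "has_bochner_integral lborel (\<lambda>s. c powr (a - 1) * tpow (a - 1) s * exp (- (c * s))) (Gamma a / c)"
    using assms by (simp add: tpow_mult divide_inverse_commute)
  then have "has_bochner_integral lborel (\<lambda>s. c powr (1 - a) * (c powr (a - 1) * tpow (a - 1) s * exp (- (c * s))))
    (c powr (1 - a) * (Gamma a / c))" by (rule has_bochner_integral_mult_right)
  moreover have "c powr (1 - a) * (c powr (a - 1) * y * z) = y * z" for y z :: real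
    using assms by (simp flip: mult.assoc powr_add)
  moreover have "c powr (1 - a) * (Gamma a / c) = Gamma a * c powr (- a)"
    using assms by (simp add: powr_diff powr_minus field_simps)
  ultimately have "has_bochner_integral lborel (\<lambda>s. tpow (a - 1) s * exp (- (c * s))) (Gamma a * c powr (- a))"
    by (simp only:)
  then show ?thesis by (simp add: mult.commute[of c])
qed

text \<open>The orders \<open>a\<close> and \<open>1 - a\<close> of fractional integration add to 1,
  so the convolution of the kernels is constant on the half line, with value B(a, 1 - a). This is
  the heart of Abel inversion.\<close>

lemma tpow_beta_integral:
  assumes "0 < a" "a < 1"
  shows "has_bochner_integral lborel (\<lambda>u. tpow (a - 1) u * tpow (- a) (w - u)) (indicator {0<..} w * (Gamma a * Gamma (1 - a)))"
proof (cases "w > 0")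
  case True
  have B: "Beta a (1 - a) = Gamma a * Gamma (1 - a)" by (simp add: Beta_def)
  have "has_bochner_integral lborel (\<lambda>t. indicator {0..1} t * (t powr (a - 1) * (1 - t) powr ((1 - a) - 1))) (Beta a (1 - a))"
    by (rule has_bochner_integral_nonneg_has_integral[OF _ _ _ has_integral_Beta_real]) (use assms in auto)
  moreover have "indicator {0..1} t * (t powr (a - 1) * (1 - t) powr ((1 - a) - 1)) = tpow (a - 1) t * tpow (- a) (1 - t)" for t :: real
    by (auto simp: tpow_def indicator_def)
  ultimately have "has_bochner_integral lborel (\<lambda>t. tpow (a - 1) t * tpow (- a) (1 - t)) (Gamma a * Gamma (1 - a))"
    unfolding B by simp
  from lborel_has_bochner_integral_real_affine_iff[THEN iffD1, OF _ this, of "1 / w" 0]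
  have "has_bochner_integral lborel (\<lambda>u. tpow (a - 1) ((1 / w) * u) * tpow (- a) (1 - (1 / w) * u)) (Gamma a * Gamma (1 - a) * w)"
    using True by (simp add: mult.commute)
  then have "has_bochner_integral lborel (\<lambda>u. (1 / w) * (tpow (a - 1) ((1 / w) * u) * tpow (- a) (1 - (1 / w) * u))) ((1 / w) * (Gamma a * Gamma (1 - a) * w))"
    by (rule has_bochner_integral_mult_right)
  moreover have "(1 / w) * (tpow (a - 1) ((1 / w) * u) * tpow (- a) (1 - (1 / w) * u)) = tpow (a - 1) u * tpow (- a) (w - u)" for u
  proof -
    have "1 - (1 / w) * u = (1 / w) * (w - u)" using True by (simp add: field_simps)
    then have "(1 / w) * (tpow (a - 1) ((1 / w) * u) * tpow (- a) (1 - (1 / w) * u))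
      = (1 / w) * ((1 / w) powr (a - 1) * (1 / w) powr (- a)) * (tpow (a - 1) u * tpow (- a) (w - u))"
      using True by (simp add: tpow_mult del: times_divide_eq_left)
    \<comment> \<open>The exponents 1, \<open>a - 1\<close> and \<open>- a\<close> sum to 0, hence
      the independence of \<open>w\<close>.\<close>
    also have "(1 / w) * ((1 / w) powr (a - 1) * (1 / w) powr (- a)) = 1"
      unfolding powr_add[symmetric] using True by (simp add: powr_minus powr_one)
    finally show ?thesis by simp
  qed
  ultimately show ?thesis using True by (simp add: mult_ac)
next
  case False
  then have "tpow (a - 1) u * tpow (- a) (w - u) = 0" for u by (auto simp: tpow_def indicator_def)
  then show ?thesis unfolding \<open>\<And>u. tpow (a - 1) u * tpow (- a) (w - u) = 0\<close>
    using False by (simp add: has_bochner_integral_zero)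
qed

text \<open>Bernoulli's inequality (1 + s/v)^(a - 1) \<ge> 1 - (1 - a)s/v, derived from ln y \<le> y
  - 1 and exp y \<ge> 1 + y, multiplied by v^(a - 1).\<close>

lemma powr_difference_bound:
  fixes v s a :: real
  assumes "v > 0" "s > 0" "a < 1"
  shows "v powr (a - 1) - (v + s) powr (a - 1) \<le> (1 - a) * s * v powr (a - 2)"
proof -
  have "(1 - a) * ln ((v + s) / v) \<le> (1 - a) * ((v + s) / v - 1)"
    using assms by (intro mult_left_mono ln_le_minus_one) auto
  also have "(v + s) / v - 1 = s / v" using assms by (simp add: field_simps)
  finally have "1 - (1 - a) * (s / v) \<le> exp ((a - 1) * ln ((v + s) / v))"
    using exp_ge_add_one_self[of "(a - 1) * ln ((v + s) / v)"] by (simp add: algebra_simps)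
  then have "1 - (1 - a) * (s / v) \<le> ((v + s) / v) powr (a - 1)"
    using assms by (simp add: powr_def)
  then have "v powr (a - 1) * (1 - (1 - a) * (s / v)) \<le> v powr (a - 1) * ((v + s) / v) powr (a - 1)"
    by (rule mult_left_mono) simp
  also have "\<dots> = (v + s) powr (a - 1)"
    using assms by (simp add: powr_divide)
  finally have "v powr (a - 1) - (v + s) powr (a - 1) \<le> (1 - a) * s * (v powr (a - 1) / v)"
    by (simp add: algebra_simps)
  also have "v powr (a - 1) / v = v powr (a - 2)"
    using assms powr_diff[of v "a - 1" 1] by simp
  finally show ?thesis .
qed

text \<open>The fractional integral of order \<open>a\<close> of \<open>\<delta>\<^sub>0 - \<delta>\<^sub>s\<close>, up to the factor \<open>\<Gamma>(a)\<close>. Its \<open>L\<^sup>1\<close> norm is of order \<open>s\<^sup>a\<close>.\<close>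

definition abel_kernel :: "real \<Rightarrow> real \<Rightarrow> real \<Rightarrow> real"
  where "abel_kernel a s u = tpow (a - 1) u - tpow (a - 1) (u - s)"

lemma abel_kernel_measurable [measurable]: "abel_kernel a s \<in> borel_measurable borel"
  unfolding abel_kernel_def by measurable

text \<open>Up to \<open>2 * s\<close> the two singular pieces are bounded separately by
  \<open>D1\<close>, each with integral \<open>s powr a / a\<close>. Beyond \<open>2 * s\<close> the
  powers cancel to first order, and \<open>D2\<close> contributes \<open>s powr a\<close>.\<close>

lemma abel_kernel_L1:
  assumes a: "0 < a" "a < 1" and s: "s > 0"
  shows "integrable lborel (abel_kernel a s)"
    and "(\<integral>u. \<bar>abel_kernel a s u\<bar> \<partial>lborel) \<le> s powr a * (2 / a + 1)"
proof -
  define D1 where "D1 = (\<lambda>v. indicator {0..s} v * v powr (a - 1))"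
  define D2 where "D2 = (\<lambda>v. indicator {s..} v * v powr (a - 2))"
  have shift: "has_bochner_integral lborel (\<lambda>v. f (v - s)) I" if "has_bochner_integral lborel f I" for f :: "real \<Rightarrow> real" and I
    using lborel_has_bochner_integral_real_affine_iff[THEN iffD1, OF _ that, of 1 "- s"] by simp
  have D1: "has_bochner_integral lborel D1 (s powr a / a)"
    unfolding D1_def using has_integral_powr_from_0[of "a - 1" s] a s
    by (intro has_bochner_integral_nonneg_has_integral) auto
  have "((\<lambda>v. v powr (a - 2)) has_integral - (s powr ((a - 2) + 1)) / ((a - 2) + 1)) {s..}"
    using a s by (intro has_integral_powr_to_inf) auto
  then have D2: "has_bochner_integral lborel D2 (- (s powr ((a - 2) + 1)) / ((a - 2) + 1))"
    unfolding D2_def by (intro has_bochner_integral_nonneg_has_integral) auto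
  define D where "D = (\<lambda>u. (D1 u + D1 (u - s)) + (1 - a) * s * D2 (u - s))"
  have D: "has_bochner_integral lborel D ((s powr a / a + s powr a / a) + (1 - a) * s * (- (s powr ((a - 2) + 1)) / ((a - 2) + 1)))"
    unfolding D_def by (intro has_bochner_integral_add has_bochner_integral_mult_right shift D1 D2)
  have "(1 - a) * s * (- (s powr ((a - 2) + 1)) / ((a - 2) + 1)) = s powr 1 * s powr (a - 1)"
    using a s by (simp add: field_simps)
  also have "\<dots> = s powr a" unfolding powr_add[symmetric] by simp
  finally have val: "(s powr a / a + s powr a / a) + (1 - a) * s * (- (s powr ((a - 2) + 1)) / ((a - 2) + 1)) = s powr a * (2 / a + 1)"
    by (simp add: algebra_simps)
  have le: "\<bar>abel_kernel a s u\<bar> \<le> D u" for u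
  proof -
    consider "u \<le> 0" | "0 < u" "u \<le> s" | "s < u" "u \<le> 2 * s" | "2 * s < u" by linarith
    then show ?thesis
    proof cases
      case 1
      then show ?thesis using s a by (simp add: abel_kernel_def tpow_def D_def D1_def D2_def)
    next
      case 2
      then show ?thesis using s a by (simp add: abel_kernel_def tpow_def D_def D1_def D2_def)
    next
      case 3
      have "u powr (a - 1) \<le> (u - s) powr (a - 1)"
        using 3 s a by (intro powr_mono2') auto
      then have "\<bar>abel_kernel a s u\<bar> \<le> (u - s) powr (a - 1)"
        using 3 s by (simp add: abel_kernel_def tpow_def)
      also have "\<dots> \<le> D u"
        using 3 s a by (simp add: D_def D1_def D2_def)
      finally show ?thesis .
    next
      case 4
      have "u powr (a - 1) \<le> (u - s) powr (a - 1)"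
        using 4 s a by (intro powr_mono2') auto
      then have "\<bar>abel_kernel a s u\<bar> = (u - s) powr (a - 1) - ((u - s) + s) powr (a - 1)"
        using 4 s by (simp add: abel_kernel_def tpow_def)
      also have "\<dots> \<le> (1 - a) * s * (u - s) powr (a - 2)"
        using 4 s a by (intro powr_difference_bound) auto
      also have "\<dots> \<le> D u"
        using 4 s a by (simp add: D_def D1_def D2_def)
      finally show ?thesis .
    qed
  qed
  have Di: "integrable lborel D" using D by (rule integrable.intros)
  show i: "integrable lborel (abel_kernel a s)"
    by (rule Bochner_Integration.integrable_bound[OF Di]) (use le in \<open>auto intro!: AE_I2 order_trans[OF le abs_ge_self]\<close>)
  have "(\<integral>u. \<bar>abel_kernel a s u\<bar> \<partial>lborel) \<le> integral\<^sup>L lborel D"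
    using i Di le by (intro integral_mono) auto
  also have "\<dots> = s powr a * (2 / a + 1)"
    using has_bochner_integral_integral_eq[OF D] unfolding val .
  finally show "(\<integral>u. \<bar>abel_kernel a s u\<bar> \<partial>lborel) \<le> s powr a * (2 / a + 1)" .
qed

section \<open>Fubini for Laplace transforms and fractional integrals\<close>

definition tpow_majorant :: "real \<Rightarrow> real \<Rightarrow> real \<Rightarrow> real"
  where "tpow_majorant K a v = K * (indicator {0..1} v * v powr (- a) + indicator {1..} v * v powr (- a - 1))"

lemma tpow_majorant_integrable:
  assumes "0 < a" "a < 1" shows "integrable lborel (tpow_majorant K a)"
proof -
  have "has_bochner_integral lborel (\<lambda>v. indicator {0..1} v * v powr (- a)) (1 powr (- a + 1) / (- a + 1))"
    by (rule has_bochner_integral_nonneg_has_integral[OF _ _ _ has_integral_powr_from_0]) (use assms in auto)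
  moreover have "has_bochner_integral lborel (\<lambda>v. indicator {1..} v * v powr (- a - 1)) (- (1 powr ((- a - 1) + 1)) / ((- a - 1) + 1))"
    by (rule has_bochner_integral_nonneg_has_integral[OF _ _ _ has_integral_powr_to_inf]) (use assms in auto)
  ultimately show ?thesis
    unfolding tpow_majorant_def
    by (intro integrable_mult_right Bochner_Integration.integrable_add) (auto intro: integrable.intros)
qed

text \<open>The constant bound controls the singularity at 0, integrable for \<open>a < 1\<close>;
  the bound \<open>K / v\<close> controls infinity, where \<open>a > 0\<close> gives
  integrability.\<close>

lemma tpow_majorant_bound:
  assumes "v > 0 \<Longrightarrow> \<bar>y\<bar> \<le> K" "v > 0 \<Longrightarrow> \<bar>y\<bar> \<le> K / v"
  shows "tpow (- a) v * \<bar>y\<bar> \<le> tpow_majorant K a v"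
proof (cases "v > 0")
  case v: True
  have K: "K \<ge> 0" using assms(1)[OF v] by linarith
  show ?thesis
  proof (cases "v \<le> 1")
    case True
    have "v powr (- a) * \<bar>y\<bar> \<le> v powr (- a) * K" using assms(1)[OF v] by (intro mult_left_mono) auto
    also have "\<dots> \<le> tpow_majorant K a v"
      using True v K by (simp add: tpow_majorant_def distrib_left mult.commute)
    finally show ?thesis using v by (simp add: tpow_def)
  next
    case False
    have "v powr (- a) * \<bar>y\<bar> \<le> v powr (- a) * (K / v)" using assms(2)[OF v] by (intro mult_left_mono) auto
    also have "\<dots> = K * v powr (- a - 1)" using v powr_diff[of v "- a" 1] by simp
    also have "\<dots> \<le> tpow_majorant K a v"
      using False v K by (simp add: tpow_majorant_def)
    finally show ?thesis using v by (simp add: tpow_def)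
  qed
next
  case False
  show ?thesis using False by (auto simp: tpow_def tpow_majorant_def indicator_def)
qed

text \<open>Integrating in \<open>s\<close> first gives \<open>Gamma a * v powr (- a)\<close>. With
  \<open>G\<close> an orbit, the inner Laplace transform is a resolvent, so Balakrishnan's integral
  becomes a fractional integral of the orbit.\<close>

lemma stieltjes_laplace:
  fixes G :: "real \<Rightarrow> real"
  assumes a: "0 < a" "a < 1" and [measurable]: "G \<in> borel_measurable borel"
    and b: "\<And>v. v > 0 \<Longrightarrow> \<bar>G v\<bar> \<le> K" "\<And>v. v > 0 \<Longrightarrow> \<bar>G v\<bar> \<le> K / v"
  shows "has_bochner_integral lborel (\<lambda>s. tpow (a - 1) s * (\<integral>v. exp (- s * v) * (indicator {0<..} v * G v) \<partial>lborel))
    (Gamma a * (\<integral>v. tpow (- a) v * G v \<partial>lborel))"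
proof -
  define f where "f = (\<lambda>(v, s). tpow (a - 1) s * (exp (- s * v) * (indicator {0<..} v * G v)))"
  have f [measurable]: "f \<in> borel_measurable (lborel \<Otimes>\<^sub>M lborel)"
    unfolding f_def by measurable
  have inner: "has_bochner_integral lborel (\<lambda>s. f (v, s)) (Gamma a * (tpow (- a) v * G v))" for v
  proof (cases "v > 0")
    case True
    have "has_bochner_integral lborel (\<lambda>s. tpow (a - 1) s * exp (- s * v) * G v) (Gamma a * v powr (- a) * G v)"
      by (intro has_bochner_integral_mult_left tpow_exp_integral a True)
    then show ?thesis using True by (simp add: f_def tpow_def mult.assoc)
  qed (simp add: f_def tpow_def has_bochner_integral_zero)
  have norm_inner: "has_bochner_integral lborel (\<lambda>s. norm (f (v, s))) (Gamma a * (tpow (- a) v * \<bar>G v\<bar>))" for v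
  proof (cases "v > 0")
    case True
    have "has_bochner_integral lborel (\<lambda>s. tpow (a - 1) s * exp (- s * v) * \<bar>G v\<bar>) (Gamma a * v powr (- a) * \<bar>G v\<bar>)"
      by (intro has_bochner_integral_mult_left tpow_exp_integral a True)
    then show ?thesis using True by (simp add: f_def tpow_def mult.assoc abs_mult)
  qed (simp add: f_def tpow_def has_bochner_integral_zero)
  have int: "integrable (lborel \<Otimes>\<^sub>M lborel) f"
  proof (rule lborel_pair.Fubini_integrable)
    show "integrable lborel (\<lambda>v. \<integral>s. norm (f (v, s)) \<partial>lborel)"
      unfolding has_bochner_integral_integral_eq[OF norm_inner]
    proof (rule Bochner_Integration.integrable_bound[OF integrable_mult_right[OF tpow_majorant_integrable[OF a, of K], of "Gamma a"]])
      have "norm (Gamma a * (tpow (- a) v * \<bar>G v\<bar>)) \<le> norm (Gamma a * tpow_majorant K a v)" for v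
      proof -
        have "tpow (- a) v * \<bar>G v\<bar> \<le> tpow_majorant K a v" by (rule tpow_majorant_bound) (use b in auto)
        then have "Gamma a * (tpow (- a) v * \<bar>G v\<bar>) \<le> Gamma a * tpow_majorant K a v"
          using Gamma_real_pos[OF a(1)] by (intro mult_left_mono) auto
        moreover have "0 \<le> Gamma a * (tpow (- a) v * \<bar>G v\<bar>)"
          using Gamma_real_pos[OF a(1)] by (intro mult_nonneg_nonneg) auto
        ultimately show ?thesis by simp
      qed
      then show "AE v in lborel. norm (Gamma a * (tpow (- a) v * \<bar>G v\<bar>)) \<le> norm (Gamma a * tpow_majorant K a v)"
        by simp
    qed measurable
    show "AE v in lborel. integrable lborel (\<lambda>s. f (v, s))"
      using inner by (intro AE_I2) (rule integrable.intros)
  qed (rule f)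
  have "has_bochner_integral lborel (\<lambda>s. \<integral>v. f (v, s) \<partial>lborel) (\<integral>s. \<integral>v. f (v, s) \<partial>lborel \<partial>lborel)"
    using lborel_pair.integrable_snd[of "\<lambda>v s. f (v, s)"] int
    by (intro has_bochner_integral_integrable) (simp add: case_prod_unfold)
  also have "(\<integral>s. \<integral>v. f (v, s) \<partial>lborel \<partial>lborel) = (\<integral>v. \<integral>s. f (v, s) \<partial>lborel \<partial>lborel)"
    using lborel_pair.Fubini_integral[of "\<lambda>v s. f (v, s)"] int by (simp add: case_prod_unfold)
  also have "\<dots> = Gamma a * (\<integral>v. tpow (- a) v * G v \<partial>lborel)"
    unfolding has_bochner_integral_integral_eq[OF inner] by simp
  finally show ?thesis by (simp add: f_def)
qed

text \<open>After the substitution \<open>w = u + v\<close> and an exchange of integrals, the inner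
  one is a difference of two constant convolutions, one starting at 0 and one at \<open>s\<close>;
  it is the indicator of (0, s] times the constant.\<close>

lemma abel_inversion:
  fixes F :: "real \<Rightarrow> real"
  assumes a: "0 < a" "a < 1" and s: "s > 0" and F [measurable]: "F \<in> borel_measurable borel"
    and b: "\<And>v. v > 0 \<Longrightarrow> \<bar>F v\<bar> \<le> K" "\<And>v. v > 0 \<Longrightarrow> \<bar>F v\<bar> \<le> K / v"
  shows "has_bochner_integral lborel (\<lambda>u. abel_kernel a s u * (\<integral>v. tpow (- a) v * F (u + v) \<partial>lborel))
    (Gamma a * Gamma (1 - a) * (\<integral>w. indicator {0<..s} w * F w \<partial>lborel))"
proof -
  define f where "f = (\<lambda>(u, w). abel_kernel a s u * (tpow (- a) (w - u) * F w))"
  have f [measurable]: "f \<in> borel_measurable (lborel \<Otimes>\<^sub>M lborel)"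
    unfolding f_def by measurable
  have k0: "abel_kernel a s u = 0" if "u \<le> 0" for u
    using that s by (simp add: abel_kernel_def tpow_def)
  have K: "K \<ge> 0" using b(1)[of 1] by linarith
  have maj: "norm (tpow (- a) v * F (u + v)) \<le> tpow_majorant K a v" if "u > 0" for u v
  proof -
    have "tpow (- a) v * \<bar>F (u + v)\<bar> \<le> tpow_majorant K a v"
    proof (rule tpow_majorant_bound)
      assume v: "v > 0"
      show "\<bar>F (u + v)\<bar> \<le> K" using b(1)[of "u + v"] that v by simp
      have "K / (u + v) \<le> K / v" using K v that by (intro divide_left_mono) auto
      then show "\<bar>F (u + v)\<bar> \<le> K / v" using b(2)[of "u + v"] that v by simp
    qed
    then show ?thesis by (simp add: abs_mult)
  qed
  have int_v: "integrable lborel (\<lambda>v. tpow (- a) v * F (u + v))" if "u > 0" for u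
    by (rule Bochner_Integration.integrable_bound[OF tpow_majorant_integrable[OF a]])
      (use maj[OF that] in \<open>auto intro!: AE_I2 intro: order_trans[OF _ abs_ge_self]\<close>)
  have shift: "has_bochner_integral lborel (\<lambda>w. tpow (- a) (w - u) * F w) I"
    if "has_bochner_integral lborel (\<lambda>v. tpow (- a) v * F (u + v)) I" for u I
    using lborel_has_bochner_integral_real_affine_iff[THEN iffD1, OF _ that, of 1 "- u"] by simp
  have inner: "has_bochner_integral lborel (\<lambda>w. f (u, w)) (abel_kernel a s u * (\<integral>v. tpow (- a) v * F (u + v) \<partial>lborel))" for u
  proof (cases "u > 0")
    case True
    then show ?thesis unfolding f_def prod.case
      by (intro has_bochner_integral_mult_right shift has_bochner_integral_integrable int_v)
  qed (simp add: f_def k0 has_bochner_integral_zero)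
  \<comment> \<open>One majorant serves all \<open>u > 0\<close>, so absolute integrability reduces
    to that of the kernel, which vanishes for \<open>u \<le> 0\<close>.\<close>
  have norm_inner: "(\<integral>w. norm (f (u, w)) \<partial>lborel) \<le> \<bar>abel_kernel a s u\<bar> * (\<integral>v. tpow_majorant K a v \<partial>lborel)" for u
  proof (cases "u > 0")
    case True
    have "(\<integral>w. norm (f (u, w)) \<partial>lborel) = (\<integral>v. norm (f (u, u + 1 * v)) \<partial>lborel)"
      using lborel_integral_real_affine[of 1 "\<lambda>w. norm (f (u, w))" u] by simp
    also have "\<dots> = (\<integral>v. \<bar>abel_kernel a s u\<bar> * norm (tpow (- a) v * F (u + v)) \<partial>lborel)"
      by (simp add: f_def abs_mult)
    also have "\<dots> = \<bar>abel_kernel a s u\<bar> * (\<integral>v. norm (tpow (- a) v * F (u + v)) \<partial>lborel)"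
      by simp
    also have "\<dots> \<le> \<bar>abel_kernel a s u\<bar> * (\<integral>v. tpow_majorant K a v \<partial>lborel)"
      by (intro mult_left_mono integral_mono integrable_norm int_v tpow_majorant_integrable maj a True) auto
    finally show ?thesis .
  qed (simp add: f_def k0)
  have int: "integrable (lborel \<Otimes>\<^sub>M lborel) f"
  proof (rule lborel_pair.Fubini_integrable)
    show "integrable lborel (\<lambda>u. \<integral>w. norm (f (u, w)) \<partial>lborel)"
    proof (rule Bochner_Integration.integrable_bound)
      show "integrable lborel (\<lambda>u. \<bar>abel_kernel a s u\<bar> * (\<integral>v. tpow_majorant K a v \<partial>lborel))"
        using abel_kernel_L1(1)[OF a s] by (intro integrable_mult_left integrable_abs)
      show "AE u in lborel. norm (\<integral>w. norm (f (u, w)) \<partial>lborel) \<le> norm (\<bar>abel_kernel a s u\<bar> * (\<integral>v. tpow_majorant K a v \<partial>lborel))"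
      proof (intro AE_I2)
        fix u
        have "0 \<le> (\<integral>w. norm (f (u, w)) \<partial>lborel)" by (rule integral_nonneg_AE) simp
        then show "norm (\<integral>w. norm (f (u, w)) \<partial>lborel) \<le> norm (\<bar>abel_kernel a s u\<bar> * (\<integral>v. tpow_majorant K a v \<partial>lborel))"
          using norm_inner[of u] by simp
      qed
    qed measurable
    show "AE u in lborel. integrable lborel (\<lambda>w. f (u, w))"
      using inner by (intro AE_I2) (rule integrable.intros)
  qed (rule f)
  have tshift: "has_bochner_integral lborel (\<lambda>u. tpow (a - 1) (u - s) * tpow (- a) (w - u)) (indicator {0<..} (w - s) * (Gamma a * Gamma (1 - a)))" for w
    using lborel_has_bochner_integral_real_affine_iff[THEN iffD1, OF _ tpow_beta_integral[OF a, of "w - s"], of 1 "- s"] by simp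
  have outer: "(\<integral>u. f (u, w) \<partial>lborel) = Gamma a * Gamma (1 - a) * (indicator {0<..s} w * F w)" for w
  proof -
    have "has_bochner_integral lborel (\<lambda>u. (tpow (a - 1) u * tpow (- a) (w - u) - tpow (a - 1) (u - s) * tpow (- a) (w - u)) * F w)
      ((indicator {0<..} w * (Gamma a * Gamma (1 - a)) - indicator {0<..} (w - s) * (Gamma a * Gamma (1 - a))) * F w)"
      by (intro has_bochner_integral_mult_left has_bochner_integral_diff tpow_beta_integral a tshift)
    from has_bochner_integral_integral_eq[OF this] show ?thesis
      using s by (auto simp: f_def abel_kernel_def indicator_def algebra_simps)
  qed
  have "has_bochner_integral lborel (\<lambda>u. \<integral>w. f (u, w) \<partial>lborel) (\<integral>u. \<integral>w. f (u, w) \<partial>lborel \<partial>lborel)"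
    using lborel_pair.integrable_fst[of "\<lambda>u w. f (u, w)"] int
    by (intro has_bochner_integral_integrable) (simp add: case_prod_unfold)
  also have "(\<integral>u. \<integral>w. f (u, w) \<partial>lborel \<partial>lborel) = (\<integral>w. \<integral>u. f (u, w) \<partial>lborel \<partial>lborel)"
    using lborel_pair.Fubini_integral[of "\<lambda>u w. f (u, w)"] int by (simp add: case_prod_unfold)
  also have "\<dots> = Gamma a * Gamma (1 - a) * (\<integral>w. indicator {0<..s} w * F w \<partial>lborel)"
    unfolding outer by simp
  finally show ?thesis
    unfolding has_bochner_integral_integral_eq[OF inner] .
qed


section \<open>Fractional powers\<close>

text \<open>Makes the final constant independent of \<alpha>: the reciprocal Gamma function is
  continuous even at 0. The interval reaches 2 because \<open>1 + a\<close> occurs as an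
  argument.\<close>

lemma rGamma_bounded: "\<exists>C>0. \<forall>a\<in>{0..2::real}. \<bar>rGamma a\<bar> \<le> C"
proof -
  have "compact ((rGamma :: real \<Rightarrow> real) ` {0..2})"
    by (intro compact_continuous_image continuous_on_rGamma) auto
  then show ?thesis
    using bounded_pos[of "(rGamma :: real \<Rightarrow> real) ` {0..2}"] compact_imp_bounded by auto
qed

lemma Gamma_reflection_sin:
  assumes "0 < a" "a < (1::real)"
  shows "Gamma a * Gamma (1 - a) = pi / sin (pi * a)"
proof -
  have "Gamma (complex_of_real a) * Gamma (1 - complex_of_real a) = of_real pi / sin (of_real pi * complex_of_real a)"
    by (rule Gamma_reflection_complex)
  then have "complex_of_real (Gamma a * Gamma (1 - a)) = complex_of_real (pi / sin (pi * a))"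
    unfolding of_real_mult of_real_divide sin_of_real[symmetric] Gamma_complex_of_real[symmetric] of_real_diff of_real_1 .
  then show ?thesis by (simp only: of_real_eq_iff)
qed

context analytic_semigroup
begin

section \<open>Scalar orbits and the resolvent as a Laplace transform\<close>

definition orbit :: "('a \<Rightarrow> real) \<Rightarrow> 'a \<Rightarrow> real \<Rightarrow> real"
  where "orbit f v w = indicator {0<..} w * f (T w v)"

lemma orbit_measurable:
  assumes "bounded_linear f" shows "orbit f v \<in> borel_measurable borel"
proof -
  have "continuous_on {0<..} (\<lambda>w. f (T w v))"
    by (intro bounded_linear.continuous_on[OF assms] T_cont_on) auto
  then have "(\<lambda>w. indicator {0<..} w *\<^sub>R f (T w v)) \<in> borel_measurable borel"
    by (intro borel_measurable_continuous_on_indicator) auto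
  then show ?thesis unfolding orbit_def by simp
qed

text \<open>The first bound is that of the semigroup. The second reads \<open>T w v\<close> as minus
  the derivative of the orbit of \<open>x\<close>, which analyticity bounds by
  \<open>M1 / w\<close>. One constant for both fits the hypotheses of
  \<open>abel_inversion\<close>.\<close>

lemma orbit_bound:
  assumes f: "\<And>x. \<bar>f x\<bar> \<le> norm x" and xv: "(x, v) \<in> A" and w: "w > 0"
  shows "\<bar>orbit f v w\<bar> \<le> M * norm v + M1 * norm x" "\<bar>orbit f v w\<bar> \<le> (M * norm v + M1 * norm x) / w"
proof -
  have 1: "norm (T w v) \<le> M * norm v" using T_norm[of w v] w by simp
  obtain d where d: "((\<lambda>r. T r x) has_vector_derivative d) (at w)" "norm d \<le> M1 / w * norm x"
    using T_deriv[OF w] by blast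
  have "d = - T w v"
    by (rule vector_derivative_unique_at[OF d(1) T_deriv_A[OF xv w]])
  then have 2: "norm (T w v) \<le> M1 * norm x / w" using d(2) by simp
  have 0: "\<bar>orbit f v w\<bar> \<le> norm (T w v)" using f[of "T w v"] w by (simp add: orbit_def)
  have "0 \<le> M1 * norm x" "0 \<le> M * norm v" using M M1 by auto
  then show "\<bar>orbit f v w\<bar> \<le> M * norm v + M1 * norm x" using 0 1 by linarith
  have "M1 * norm x / w \<le> (M * norm v + M1 * norm x) / w"
    using \<open>0 \<le> M * norm v\<close> w by (intro divide_right_mono) auto
  then show "\<bar>orbit f v w\<bar> \<le> (M * norm v + M1 * norm x) / w" using 0 2 by linarith
qed

lemma orbit_derivative:
  assumes f: "bounded_linear f" and wz: "(w, z) \<in> A" and r: "r > 0"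
  shows "((\<lambda>r. f (T r w)) has_real_derivative - f (T r z)) (at r)"
proof -
  have "((\<lambda>r. f (T r w)) has_vector_derivative f (- T r z)) (at r)"
    by (rule bounded_linear.has_vector_derivative[OF f T_deriv_A[OF wz r]])
  then show ?thesis
    by (simp add: has_real_derivative_iff_has_vector_derivative linear_neg[OF bounded_linear.linear[OF f]])
qed

text \<open>With \<open>w\<close> the resolvent applied to \<open>v\<close>, A w = v - s w, so
  \<phi> is an antiderivative of the integrand and decays at infinity. The shift
  \<open>u > 0\<close> makes it differentiable also at \<tau> = 0.\<close>

lemma laplace_resolvent:
  assumes f: "bounded_linear f" "\<And>x. \<bar>f x\<bar> \<le> norm x" and s: "s > 0" and u: "u > 0"
  shows "(\<integral>\<tau>. exp (- s * \<tau>) * (indicator {0<..} \<tau> * orbit f v (u + \<tau>)) \<partial>lborel)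
    = f (T u (bounded_op ((op_affine s 1 A)\<inverse>) v))"
proof -
  interpret f: bounded_linear f by (rule f(1))
  define w where "w = bounded_op ((op_affine s 1 A)\<inverse>) v"
  have w: "w = (1 / s) *\<^sub>R R (1 / s) v"
    unfolding w_def using bounded_op_affine[of s 1] s by (simp add: blinfun.scaleR_left)
  have "(0 + (1 / s) *\<^sub>R R (1 / s) v, 0 + (1 / s) *\<^sub>R (1 / (1 / s)) *\<^sub>R (v - R (1 / s) v)) \<in> A"
    using s by (intro A_add_scale A_0 R_A) simp
  then have wA: "(w, v - s *\<^sub>R w) \<in> A" using s by (simp add: w)
  define \<phi> where "\<phi> = (\<lambda>\<tau>. - (exp (- s * \<tau>) * f (T (u + \<tau>) w)))"
  define g where "g = (\<lambda>\<tau>. exp (- s * \<tau>) * f (T (u + \<tau>) v))"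
  have cg: "continuous_on {0<..} g"
  proof -
    have "continuous_on {0<..} ((\<lambda>\<tau>. f (T \<tau> v)) \<circ> (\<lambda>\<tau>. u + \<tau>))"
      using u by (intro continuous_on_compose f.continuous_on T_cont_on continuous_intros) auto
    then show ?thesis unfolding g_def o_def by (intro continuous_intros)
  qed
  have d\<phi>: "(\<phi> has_real_derivative g \<tau>) (at \<tau>)" if "\<tau> \<ge> 0" for \<tau>
  proof -
    have "((\<lambda>r. f (T r w)) has_real_derivative - f (T (u + \<tau>) (v - s *\<^sub>R w))) (at (\<tau> + u))"
      using orbit_derivative[OF f(1) wA, of "u + \<tau>"] u that by (simp add: add.commute)
    then have "((\<lambda>\<tau>. f (T (u + \<tau>) w)) has_real_derivative - f (T (u + \<tau>) (v - s *\<^sub>R w))) (at \<tau>)"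
      by (subst (asm) DERIV_shift) (simp add: add.commute)
    then show ?thesis
      unfolding \<phi>_def g_def
      by (auto intro!: derivative_eq_intros simp: blinfun.bilinear_simps f.diff f.scaleR algebra_simps)
  qed
  have decay: "((\<lambda>\<tau>. exp (- \<tau> / (1 / s)) * (M * norm x + \<tau> * 0)) \<longlongrightarrow> 0) at_top" for x :: 'a
    by (rule exp_decay) (use s in simp)
  have bnd: "\<bar>exp (- s * \<tau>) * f (T (u + \<tau>) x)\<bar> \<le> exp (- \<tau> / (1 / s)) * (M * norm x + \<tau> * 0)" if "\<tau> \<ge> 0" for \<tau> and x
    using f(2)[of "T (u + \<tau>) x"] T_norm[of "u + \<tau>" x] u that
    by (simp add: abs_mult mult.commute[of s])
  have lim: "(\<phi> \<longlongrightarrow> 0) at_top"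
  proof (rule Lim_null_comparison[OF _ decay[of w]])
    show "\<forall>\<^sub>F \<tau> in at_top. norm (\<phi> \<tau>) \<le> exp (- \<tau> / (1 / s)) * (M * norm w + \<tau> * 0)"
      using eventually_ge_at_top[of 0] by eventually_elim (use bnd in \<open>simp add: \<phi>_def\<close>)
  qed
  have gi: "set_integrable lborel {0<..} g"
    unfolding set_integrable_def
  proof (rule Bochner_Integration.integrable_bound)
    \<comment> \<open>The Gamma integral with \<open>a = 1\<close>: the power is then the indicator
      of the positive half line and only the exponential remains.\<close>
    have "has_bochner_integral lborel (\<lambda>\<tau>. tpow (1 - 1) \<tau> * exp (- \<tau> * s)) (Gamma 1 * s powr (- 1))"
      by (rule tpow_exp_integral) (use s in auto)
    then show "integrable lborel (\<lambda>\<tau>. M * norm v * (tpow (1 - 1) \<tau> * exp (- \<tau> * s)))"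
      by (intro integrable_mult_right) (rule integrable.intros)
    show "(\<lambda>\<tau>. indicator {0<..} \<tau> *\<^sub>R g \<tau>) \<in> borel_measurable lborel"
      using borel_measurable_continuous_on_indicator[OF _ cg] by simp
    show "AE \<tau> in lborel. norm (indicator {0<..} \<tau> *\<^sub>R g \<tau>) \<le> norm (M * norm v * (tpow (1 - 1) \<tau> * exp (- \<tau> * s)))"
    proof (rule AE_I2)
      fix \<tau> :: real
      show "norm (indicator {0<..} \<tau> *\<^sub>R g \<tau>) \<le> norm (M * norm v * (tpow (1 - 1) \<tau> * exp (- \<tau> * s)))"
        using bnd[of \<tau> v] M by (auto simp: g_def tpow_def indicator_def mult.commute)
    qed
  qed
  have "(LBINT \<tau>=ereal 0..\<infinity>. g \<tau>) = 0 - \<phi> 0"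
  proof (rule interval_integral_FTC_integrable)
    show "(\<phi> has_vector_derivative g \<tau>) (at \<tau>)" if "ereal 0 < ereal \<tau>" "ereal \<tau> < \<infinity>" for \<tau>
      using d\<phi>[of \<tau>] that by (simp add: has_real_derivative_iff_has_vector_derivative)
    show "isCont g \<tau>" if "ereal 0 < ereal \<tau>" "ereal \<tau> < \<infinity>" for \<tau>
      using cg that by (simp add: continuous_on_eq_continuous_at)
    show "set_integrable lborel (einterval (ereal 0) \<infinity>) g" using gi by simp
    show "((\<phi> \<circ> real_of_ereal) \<longlongrightarrow> \<phi> 0) (at_right (ereal 0))"
      using DERIV_isCont[OF d\<phi>[of 0]] unfolding ereal_tendsto_simps isCont_def
      by (simp add: filterlim_at_split)
    show "((\<phi> \<circ> real_of_ereal) \<longlongrightarrow> 0) (at_left \<infinity>)"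
      using lim unfolding ereal_tendsto_simps .
  qed simp
  then have "(LINT \<tau>:{0<..}|lborel. g \<tau>) = f (T u w)"
    by (simp add: interval_integral_to_infinity_eq \<phi>_def)
  moreover have "indicator {0<..} \<tau> *\<^sub>R g \<tau> = exp (- s * \<tau>) * (indicator {0<..} \<tau> * orbit f v (u + \<tau>))" for \<tau>
    using u by (auto simp: g_def orbit_def indicator_def)
  ultimately show ?thesis
    unfolding set_lebesgue_integral_def w_def by (simp only:)
qed

lemma orbit_integral:
  assumes f: "bounded_linear f" and xv: "(x, v) \<in> A" and s: "s > 0"
  shows "(\<integral>w. indicator {0<..s} w * orbit f v w \<partial>lborel) = f x - f (T s x)"
proof -
  have cont: "continuous_on {0..s} (\<lambda>r. - f (T r x))" "continuous_on {0..s} (\<lambda>r. f (T r v))"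
    by (intro continuous_intros bounded_linear.continuous_on[OF f] T_cont_on; simp)+
  have fi: "set_integrable lborel {0..s} (\<lambda>r. f (T r v))"
    by (rule borel_integrable_atLeastAtMost'[OF cont(2)])
  have "(LBINT r=ereal 0..ereal s. f (T r v)) = - f (T s x) - (- f (T 0 x))"
  proof (rule interval_integral_FTC_integrable)
    show "((\<lambda>r. - f (T r x)) has_vector_derivative f (T r v)) (at r)" if "ereal 0 < ereal r" "ereal r < ereal s" for r
      using DERIV_minus[OF orbit_derivative[OF f xv, of r]] that
      by (simp add: has_real_derivative_iff_has_vector_derivative)
    show "isCont (\<lambda>r. f (T r v)) r" if "ereal 0 < ereal r" "ereal r < ereal s" for r
      using continuous_on_interior[OF cont(2), of r] that by simp
    show "set_integrable lborel (einterval (ereal 0) (ereal s)) (\<lambda>r. f (T r v))"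
      using set_integrable_subset[OF fi, of "{0<..<s}"] by (simp add: greaterThanLessThan_subseteq_atLeastAtMost_iff)
    have "((\<lambda>r. - f (T r x)) \<longlongrightarrow> - f (T 0 x)) (at 0 within {0..s})"
      by (rule cont(1)[unfolded continuous_on_def, rule_format]) (use s in simp)
    then show "(((\<lambda>r. - f (T r x)) \<circ> real_of_ereal) \<longlongrightarrow> - f (T 0 x)) (at_right (ereal 0))"
      unfolding ereal_tendsto_simps using s by (simp add: at_within_Icc_at_right)
    have "((\<lambda>r. - f (T r x)) \<longlongrightarrow> - f (T s x)) (at s within {0..s})"
      by (rule cont(1)[unfolded continuous_on_def, rule_format]) (use s in simp)
    then show "(((\<lambda>r. - f (T r x)) \<circ> real_of_ereal) \<longlongrightarrow> - f (T s x)) (at_left (ereal s))"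
      unfolding ereal_tendsto_simps using s by (simp add: at_within_Icc_at_left)
  qed (use s in simp)
  then have "(LINT r:{0<..s}|lborel. f (T r v)) = f x - f (T s x)"
    using s by (simp add: interval_integral_Ioc)
  moreover have "indicator {0<..s} r *\<^sub>R f (T r v) = indicator {0<..s} r * orbit f v r" for r
    by (auto simp: orbit_def indicator_def)
  ultimately show ?thesis unfolding set_lebesgue_integral_def by (simp only:)
qed

text \<open>Applying \<open>f\<close> after \<open>T u\<close> turns resolvents into Laplace
  transforms of the scalar orbit, and \<open>stieltjes_laplace\<close> evaluates the integral over
  \<open>s\<close>. With the factor sin(\<pi>a)/\<pi> this represents e^(-uA) A^a x as a fractional
  integral of order 1 - a.\<close>

lemma balakrishnan_orbit:
  assumes a: "0 < a" "a < 1" and f: "bounded_linear f" "\<And>x. \<bar>f x\<bar> \<le> norm x"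
    and xv: "(x, v) \<in> A" and u: "u > 0"
    and Y: "((\<lambda>s. (s powr (a - 1)) *\<^sub>R bounded_op ((op_affine s 1 A)\<inverse>) v) has_integral Y) {0<..}"
  shows "f (T u Y) = Gamma a * (\<integral>\<tau>. tpow (- a) \<tau> * orbit f v (u + \<tau>) \<partial>lborel)"
proof -
  let ?r = "\<lambda>s. bounded_op ((op_affine s 1 A)\<inverse>) v"
  let ?L = "\<lambda>s. \<integral>\<tau>. exp (- s * \<tau>) * (indicator {0<..} \<tau> * orbit f v (u + \<tau>)) \<partial>lborel"
  let ?I = "Gamma a * (\<integral>\<tau>. tpow (- a) \<tau> * orbit f v (u + \<tau>) \<partial>lborel)"
  interpret f: bounded_linear f by (rule f(1))
  let ?K = "M * norm v + M1 * norm x"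
  have K: "?K \<ge> 0" using M M1 by simp
  note [measurable] = orbit_measurable[OF f(1)]
  have "bounded_linear (\<lambda>y. f (T u y))"
    by (rule bounded_linear_compose[OF f(1) blinfun.bounded_linear_right])
  from has_integral_linear[OF Y this]
  have 1: "((\<lambda>s. s powr (a - 1) * f (T u (?r s))) has_integral f (T u Y)) {0<..}"
    by (simp add: o_def blinfun.scaleR_right f.scaleR)
  have "has_bochner_integral lborel (\<lambda>s. tpow (a - 1) s * ?L s) ?I"
  proof (rule stieltjes_laplace[OF a])
    fix \<tau> :: real assume \<tau>: "\<tau> > 0"
    show "\<bar>orbit f v (u + \<tau>)\<bar> \<le> ?K"
      using orbit_bound(1)[OF f(2) xv, of "u + \<tau>"] u \<tau> by simp
    have "\<bar>orbit f v (u + \<tau>)\<bar> \<le> ?K / (u + \<tau>)"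
      using orbit_bound(2)[OF f(2) xv, of "u + \<tau>"] u \<tau> by simp
    also have "\<dots> \<le> ?K / \<tau>" using K u \<tau> by (intro divide_left_mono) auto
    finally show "\<bar>orbit f v (u + \<tau>)\<bar> \<le> ?K / \<tau>" .
  qed measurable
  then have "((\<lambda>s. tpow (a - 1) s * ?L s) has_integral ?I) UNIV"
    using has_integral_integral_lborel[of "\<lambda>s. tpow (a - 1) s * ?L s"]
    by (simp add: has_bochner_integral_iff)
  moreover have "tpow (a - 1) s * ?L s = (if s \<in> {0<..} then s powr (a - 1) * f (T u (?r s)) else 0)" for s
    using laplace_resolvent[OF f, of s u v] u by (auto simp: tpow_def)
  ultimately have "((\<lambda>s. s powr (a - 1) * f (T u (?r s))) has_integral ?I) {0<..}"
    by (simp only: has_integral_restrict_UNIV)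
  with 1 show ?thesis by (rule has_integral_unique)
qed

lemma balakrishnan_holder:
  assumes a: "0 < a" "a < 1" and xy: "(x, y) \<in> balakrishnan A a" and s: "s > 0"
  shows "norm (x - T s x) \<le> M * (2 * rGamma (1 + a) + rGamma a) * s powr a * norm y"
proof (rule norm_le_functionals)
  fix f :: "'a \<Rightarrow> real" assume f: "bounded_linear f" "\<And>x. \<bar>f x\<bar> \<le> norm x"
  interpret f: bounded_linear f by (rule f(1))
  obtain Y v where y: "y = (sin (pi * a) / pi) *\<^sub>R Y" and xv: "(x, v) \<in> A"
    and Y: "((\<lambda>s. (s powr (a - 1)) *\<^sub>R bounded_op ((op_affine s 1 A)\<inverse>) v) has_integral Y) {0<..}"
    using xy unfolding balakrishnan_def by blast
  have Ga: "Gamma a > 0" by (rule Gamma_real_pos[OF a(1)])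
  have "Gamma (1 - a) > 0" by (rule Gamma_real_pos) (use a in simp)
  \<comment> \<open>A vanishing sine would make the quotient in the reflection formula 0 by
    convention, contradicting the positivity of both Gamma values.\<close>
  then have sin: "sin (pi * a) / pi * (Gamma a * Gamma (1 - a)) = 1"
    using mult_pos_pos[OF Ga, of "Gamma (1 - a)"] unfolding Gamma_reflection_sin[OF a]
    by (cases "sin (pi * a) = 0") auto
  let ?F = "\<lambda>u. \<integral>\<tau>. tpow (- a) \<tau> * orbit f v (u + \<tau>) \<partial>lborel"
  note [measurable] = orbit_measurable[OF f(1)]
  have abel: "has_bochner_integral lborel (\<lambda>u. abel_kernel a s u * ?F u) (Gamma a * Gamma (1 - a) * (f x - f (T s x)))"
    using abel_inversion[OF a s orbit_measurable[OF f(1)] orbit_bound[OF f(2) xv]]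
    unfolding orbit_integral[OF f(1) xv s] .
  let ?c = "sin (pi * a) / pi * Gamma a"
  have "has_bochner_integral lborel (\<lambda>u. ?c * (abel_kernel a s u * ?F u)) (?c * (Gamma a * Gamma (1 - a) * (f x - f (T s x))))"
    by (intro has_bochner_integral_mult_right abel)
  also have "?c * (Gamma a * Gamma (1 - a) * (f x - f (T s x))) = Gamma a * (f x - f (T s x)) * (sin (pi * a) / pi * (Gamma a * Gamma (1 - a)))"
    by (simp add: mult_ac)
  finally have I: "has_bochner_integral lborel (\<lambda>u. ?c * (abel_kernel a s u * ?F u)) (Gamma a * (f x - f (T s x)))"
    unfolding sin by simp
  \<comment> \<open>For \<open>u > 0\<close> the product \<open>?c * ?F u\<close> is the scalar
    value of e^(-uA) y; for \<open>u \<le> 0\<close> the kernel vanishes.\<close>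
  have le: "norm (?c * (abel_kernel a s u * ?F u)) \<le> M * norm y * \<bar>abel_kernel a s u\<bar>" for u
  proof (cases "u > 0")
    case True
    have "?c * (abel_kernel a s u * ?F u) = abel_kernel a s u * f (T u y)"
      unfolding y using balakrishnan_orbit[OF a f xv True Y]
      by (simp add: blinfun.scaleR_right f.scaleR)
    moreover have "\<bar>f (T u y)\<bar> \<le> M * norm y"
      using f(2)[of "T u y"] T_norm[of u y] True by simp
    ultimately show ?thesis
      using mult_right_mono[of "\<bar>f (T u y)\<bar>" "M * norm y" "\<bar>abel_kernel a s u\<bar>"]
      by (simp add: abs_mult mult.commute)
  next
    case False
    then show ?thesis using s by (simp add: abel_kernel_def tpow_def)
  qed
  have "\<bar>Gamma a * (f x - f (T s x))\<bar> = norm (\<integral>u. ?c * (abel_kernel a s u * ?F u) \<partial>lborel)"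
    unfolding has_bochner_integral_integral_eq[OF I] by simp
  also have "\<dots> \<le> (\<integral>u. M * norm y * \<bar>abel_kernel a s u\<bar> \<partial>lborel)"
  proof (rule order_trans[OF Bochner_Integration.integral_norm_bound Bochner_Integration.integral_mono[OF _ _ le]])
    show "integrable lborel (\<lambda>u. norm (?c * (abel_kernel a s u * ?F u)))"
      using I by (intro integrable_norm) (rule integrable.intros)
    show "integrable lborel (\<lambda>u. M * norm y * \<bar>abel_kernel a s u\<bar>)"
      by (intro integrable_mult_right integrable_abs abel_kernel_L1(1)[OF a s])
  qed
  also have "\<dots> = M * norm y * (\<integral>u. \<bar>abel_kernel a s u\<bar> \<partial>lborel)"
    by simp
  also have "\<dots> \<le> M * norm y * (s powr a * (2 / a + 1))"
    using M by (intro mult_left_mono abel_kernel_L1(2)[OF a s]) auto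
  finally have "\<bar>f x - f (T s x)\<bar> * Gamma a \<le> M * norm y * (s powr a * (2 / a + 1))"
    using Ga by (simp add: abs_mult mult.commute)
  then have "\<bar>f x - f (T s x)\<bar> \<le> M * norm y * (s powr a * (2 / a + 1)) / Gamma a"
    using Ga by (simp add: pos_le_divide_eq)
  also have "\<dots> = M * ((2 / a + 1) * rGamma a) * s powr a * norm y"
    by (simp add: rGamma_inverse_Gamma field_simps)
  \<comment> \<open>Since a Gamma(a) = Gamma(1 + a), the blow-up of the kernel norm as
    \<open>a\<close> tends to 0 is absorbed.\<close>
  also have "(2 / a + 1) * rGamma a = 2 * rGamma (1 + a) + rGamma a"
    using rGamma_plus1[of a] a by (simp add: add.commute field_simps)
  finally show "\<bar>f (x - T s x)\<bar> \<le> M * (2 * rGamma (1 + a) + rGamma a) * s powr a * norm y"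
    by (simp add: f.diff)
qed

text \<open>Interpolation through \<open>x = x\<^sub>0 + x\<^sub>1\<close>, where \<open>x\<^sub>1\<close> is the mean of the orbit over \<open>[0, t]\<close>.\<close>

lemma interpolate_balakrishnan:
  fixes E :: "'a \<Rightarrow>\<^sub>L 'a"
  assumes t: "t > 0" and b: "b \<ge> 0"
    and E: "\<And>x G. endpoint_bound t x G \<Longrightarrow> norm (E x) \<le> b * G"
    and D: "\<And>s. s > 0 \<Longrightarrow> norm (x - T s x) \<le> C * s powr a * N" and a: "a > 0" and N: "N \<ge> 0" "C \<ge> 0"
  shows "norm (E x) \<le> 2 * C * b * t powr (a - 1) * N"
proof -
  define W where "W = integral {0..t} (\<lambda>s. T s x)"
  have WA: "(W, x - T t x) \<in> A"
    using A_integral[of t 0 x] t unfolding W_def by simp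
  define x1 where "x1 = (1 / t) *\<^sub>R W"
  have x1: "(x1, (1 / t) *\<^sub>R (x - T t x)) \<in> A"
    using A_add_scale[OF A_0 WA, of "1 / t"] unfolding x1_def by simp
  let ?B = "C * t powr a * N"
  have B: "norm (x - T s x) \<le> ?B" if "s \<in> {0..t}" for s
  proof (cases "s = 0")
    case True
    then show ?thesis using N by simp
  next
    case False
    then have "norm (x - T s x) \<le> C * s powr a * N" using D[of s] that by simp
    also have "\<dots> \<le> ?B" using that a N by (intro mult_right_mono mult_left_mono powr_mono2) auto
    finally show ?thesis .
  qed
  have "((\<lambda>s. x - T s x) has_integral t *\<^sub>R x - W) {0..t}"
    unfolding W_def using t has_integral_const_real[of x 0 t]
    by (intro has_integral_diff integrable_integral integrable_continuous_real T_cont_on) auto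
  then have "norm (t *\<^sub>R x - W) \<le> ?B * measure lborel {0..t}"
    using B N by (intro has_integral_bound_real) auto
  then have "norm (t *\<^sub>R x - W) \<le> ?B * t" using t by simp
  moreover have "x - x1 = (1 / t) *\<^sub>R (t *\<^sub>R x - W)" unfolding x1_def using t by (simp add: algebra_simps)
  ultimately have x0: "norm (x - x1) \<le> ?B" using t by (simp add: pos_divide_le_eq)
  \<comment> \<open>The rough part takes the endpoint \<alpha> = 0. The smooth part takes \<alpha> =
    1, where A x1 is (x - \<open>T t x\<close>) / t. Both contributions have the same size.\<close>
  have "norm (E (x - x1)) \<le> b * (norm (x - x1) / t)"
    by (rule E) (simp add: endpoint_bound_def)
  also have "\<dots> \<le> b * (?B / t)" using x0 b t by (intro mult_left_mono divide_right_mono) auto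
  finally have 1: "norm (E (x - x1)) \<le> b * (?B / t)" .
  have "norm (E x1) \<le> b * norm ((1 / t) *\<^sub>R (x - T t x))"
    by (rule E) (use x1 in \<open>auto simp: endpoint_bound_def\<close>)
  also have "\<dots> \<le> b * (?B / t)"
    using B[of t] b t by (intro mult_left_mono) (auto intro: divide_right_mono)
  finally have 2: "norm (E x1) \<le> b * (?B / t)" .
  have "norm (E x) \<le> norm (E (x - x1)) + norm (E x1)"
    using norm_triangle_ineq[of "E (x - x1)" "E x1"] by (simp add: blinfun.diff_right)
  also have "\<dots> \<le> b * (?B / t) + b * (?B / t)" by (intro add_mono 1 2)
  also have "\<dots> = 2 * C * b * (t powr a / t) * N" by (simp add: field_simps)
  also have "t powr a / t = t powr (a - 1)" using t powr_diff[of t a 1] by simp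
  finally show ?thesis .
qed

text \<open>The factor 6 is 2 from the splitting times 3 values of the reciprocal Gamma function;
  the summand 1 covers the endpoints. The estimate depends continuously on the pair, so it passes
  from Balakrishnan's operator to its closure.\<close>

lemma interpolate:
  fixes E :: "'a \<Rightarrow>\<^sub>L 'a"
  assumes t: "t > 0" and b: "b \<ge> 0" and a: "0 \<le> a" "a \<le> 1"
    and E: "\<And>x G. endpoint_bound t x G \<Longrightarrow> norm (E x) \<le> b * G"
    and C: "C \<ge> 0" "\<And>a. a \<in> {0..2} \<Longrightarrow> \<bar>rGamma a\<bar> \<le> C"
    and xy: "(x, y) \<in> frac_power A a"
  shows "norm (E x) \<le> (6 * M * C + 1) * b * t powr (a - 1) * norm y"
proof -
  consider "a = 0" | "a = 1" | "0 < a" "a < 1" using a by linarith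
  then show ?thesis
  proof cases
    case 1
    then have "norm (E x) \<le> b * (norm y / t)"
      using xy E[of x "norm x / t"] by (simp add: frac_power_def endpoint_bound_def)
    also have "\<dots> = 1 * (b * t powr (a - 1) * norm y)"
      using 1 t by (simp add: powr_minus field_simps)
    also have "\<dots> \<le> (6 * M * C + 1) * (b * t powr (a - 1) * norm y)"
      using M C b by (intro mult_right_mono) auto
    finally show ?thesis by (simp add: mult.assoc)
  next
    case 2
    then have "norm (E x) \<le> 1 * (b * t powr (a - 1) * norm y)"
      using xy E[of x "norm y"] t by (auto simp: frac_power_def endpoint_bound_def)
    also have "\<dots> \<le> (6 * M * C + 1) * (b * t powr (a - 1) * norm y)"
      using M C b by (intro mult_right_mono) auto
    finally show ?thesis by (simp add: mult.assoc)
  next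
    case 3
    have core: "norm (E x) \<le> (6 * M * C + 1) * b * t powr (a - 1) * norm y" if "(x, y) \<in> balakrishnan A a" for x y
    proof -
      have "norm (E x) \<le> 2 * (3 * M * C) * b * t powr (a - 1) * norm y"
      proof (rule interpolate_balakrishnan[OF t b E _ 3(1)])
        fix s :: real assume s: "s > 0"
        have "norm (x - T s x) \<le> M * (2 * rGamma (1 + a) + rGamma a) * s powr a * norm y"
          by (rule balakrishnan_holder[OF 3 that s])
        also have "\<dots> \<le> M * (3 * C) * s powr a * norm y"
          using C(2)[of "1 + a"] C(2)[of a] 3 M by (intro mult_right_mono mult_left_mono) (auto simp: abs_le_iff)
        finally show "norm (x - T s x) \<le> 3 * M * C * s powr a * norm y" by (simp add: mult_ac)
      qed (use M C in auto)
      also have "\<dots> = (6 * M * C) * (b * t powr (a - 1) * norm y)" by simp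
      also have "\<dots> \<le> (6 * M * C + 1) * (b * t powr (a - 1) * norm y)"
        using b by (intro mult_right_mono) auto
      finally show ?thesis by (simp add: mult.assoc)
    qed
    have "(x, y) \<in> closure (balakrishnan A a)" using xy 3 by (simp add: frac_power_def)
    then obtain z where z: "\<And>n. z n \<in> balakrishnan A a" "z \<longlonglongrightarrow> (x, y)"
      unfolding closure_sequential by blast
    have "(\<lambda>n. norm (E (fst (z n)))) \<longlonglongrightarrow> norm (E (fst (x, y)))"
      by (intro tendsto_intros z)
    moreover have "(\<lambda>n. (6 * M * C + 1) * b * t powr (a - 1) * norm (snd (z n))) \<longlonglongrightarrow> (6 * M * C + 1) * b * t powr (a - 1) * norm (snd (x, y))"
      by (intro tendsto_intros z)
    ultimately show ?thesis
      using core[of "fst (z _)" "snd (z _)"] z(1) by (auto intro: LIMSEQ_le)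
  qed
qed

end


section \<open>Rates for all exponents\<close>

text \<open>Around \<open>t\<close> the sector contains a disc of radius proportional to
  \<open>t\<close>, so Cauchy's estimate bounds the derivative of an orbit by a multiple of
  \<open>norm x / t\<close>.\<close>

lemma bounded_analytic_estimates:
  assumes "bounded_analytic_C0_semigroup T"
  shows "\<exists>M M1. analytic_semigroup T M M1"
proof -
  have C0: "C0_semigroup T" using assms by (simp add: bounded_analytic_C0_semigroup_def)
  obtain \<theta> S where \<theta>: "0 < \<theta>" "\<theta> \<le> pi / 2" and S: "analytic_ops_on S (sector \<theta>)"
    "\<And>t. t > 0 \<Longrightarrow> S (complex_of_real t) = T t"
    and bdd: "\<And>\<theta>'. 0 < \<theta>' \<Longrightarrow> \<theta>' < \<theta> \<Longrightarrow> bounded (S ` sector \<theta>')"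
    using assms unfolding bounded_analytic_C0_semigroup_def by blast
  \<comment> \<open>Boundedness is given only on strictly smaller sectors, so the discs are placed
    in the one of half the angle.\<close>
  define \<theta>' where "\<theta>' = \<theta> / 2"
  have \<theta>': "0 < \<theta>'" "\<theta>' < \<theta>" using \<theta> by (simp_all add: \<theta>'_def)
  have sub: "sector \<theta>' \<subseteq> sector \<theta>" using \<theta>' by (auto simp: sector_def)
  obtain B where B: "\<And>z. z \<in> sector \<theta>' \<Longrightarrow> norm (S z) \<le> B"
    using bdd[OF \<theta>'] unfolding bounded_iff by blast
  obtain \<rho> where \<rho>: "\<rho> > 0" "\<And>t. t > 0 \<Longrightarrow> cball (complex_of_real t) (\<rho> * t) \<subseteq> sector \<theta>'"
    using sector_ball[OF \<theta>'(1)] by blast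
  define M where "M = max 1 B"
  define M1 where "M1 = max 1 (2 * M / \<rho>)"
  have SM: "norm (S z x) \<le> M * norm x" if "z \<in> sector \<theta>'" for z x
  proof -
    have "norm (S z x) \<le> norm (S z) * norm x" by (rule norm_blinfun)
    also have "\<dots> \<le> M * norm x" using B[OF that] by (intro mult_right_mono) (auto simp: M_def)
    finally show ?thesis .
  qed
  have "analytic_semigroup T M M1"
  proof
    show T0: "T 0 = id_blinfun" using C0 by (simp add: C0_semigroup_def)
    show "T (s + t) x = T s (T t x)" if "s \<ge> 0" "t \<ge> 0" for s t x
      using C0 that by (simp add: C0_semigroup_def)
    show "((\<lambda>t. T t x) \<longlongrightarrow> x) (at_right 0)" for x
      using C0 by (simp add: C0_semigroup_def)
    show "norm (T t x) \<le> M * norm x" if "t \<ge> 0" for t x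
    proof (cases "t = 0")
      case True
      then show ?thesis using mult_right_mono[of 1 M "norm x"] by (simp add: T0 M_def)
    next
      case False
      then have "t > 0" using that by simp
      moreover have "complex_of_real t \<in> sector \<theta>'"
        using \<rho>(2)[OF \<open>t > 0\<close>] \<rho>(1) \<open>t > 0\<close> by (meson centre_in_cball less_imp_le mult_pos_pos subsetD)
      ultimately show ?thesis using SM[of "complex_of_real t" x] S(2) by simp
    qed
    fix t :: real and x assume t: "t > 0"
    have ex: "\<exists>d. ((\<lambda>w. S w x) has_derivative (\<lambda>h. h *\<^sub>C d)) (at z)" if "z \<in> cball (complex_of_real t) (\<rho> * t)" for z
      using S(1) that \<rho>(2)[OF t] sub unfolding analytic_ops_on_def by (meson subsetD)
    have r: "\<rho> * t > 0" using \<rho> t by simp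
    obtain d where d: "((\<lambda>w. S w x) has_derivative (\<lambda>h. h *\<^sub>C d)) (at (complex_of_real t))"
      using ex[of "complex_of_real t"] r by (auto simp: less_imp_le)
    have "norm d \<le> 2 * (M * norm x) / (\<rho> * t)"
      by (rule cauchy_estimate[OF r ex d]) (use SM \<rho>(2)[OF t] in auto)
    also have "\<dots> = (2 * M / \<rho>) / t * norm x" by simp
    also have "\<dots> \<le> M1 / t * norm x"
      using t by (intro mult_right_mono divide_right_mono) (auto simp: M1_def)
    finally have dn: "norm d \<le> M1 / t * norm x" .
    \<comment> \<open>Restricting the complex derivative to the real axis gives the derivative in
      \<open>t\<close> with the same vector \<open>d\<close>.\<close>
    have "((\<lambda>w. S w x) \<circ> complex_of_real has_derivative (\<lambda>h. h *\<^sub>C d) \<circ> complex_of_real) (at t)"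
      using diff_chain_at[where f = complex_of_real and g = "\<lambda>w. S w x", OF _ d]
        bounded_linear_imp_has_derivative[OF bounded_linear_of_real] by blast
    then have "((\<lambda>r. S (complex_of_real r) x) has_vector_derivative d) (at t)"
      by (simp add: has_vector_derivative_def o_def scaleR_scaleC)
    then have "((\<lambda>r. T r x) has_vector_derivative d) (at t)"
      by (rule has_vector_derivative_transform_within_open[where S = "{0<..}"]) (use t S(2) in auto)
    then show "\<exists>d. ((\<lambda>r. T r x) has_vector_derivative d) (at t) \<and> norm d \<le> M1 / t * norm x"
      using dn by (intro exI conjI)
  qed (auto simp: M_def M1_def)
  then show ?thesis by blast
qed

theorem theorem1p4:
  fixes T :: "real \<Rightarrow> ('a::complex_banach \<Rightarrow>\<^sub>L 'a)" and A :: "'a operator"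
  assumes "bounded_analytic_C0_semigroup T"
    and "A = op_affine 0 (-1) (generator T)"
  shows "\<exists>C>0. \<forall>\<alpha>\<in>{0..1}. \<forall>t>0. \<forall>n::nat. n \<ge> 1 \<longrightarrow> (\<forall>x y. (x, y) \<in> frac_power A \<alpha> \<longrightarrow>
      norm (blinfun_apply (T t) x - blinfun_apply (yosida_approx A n t) x)
        \<le> C * inverse (real n * t powr (1 - \<alpha>)) * norm y \<and>
      norm (blinfun_apply (T t) x - blinfun_apply (dunford_segal_approx T n t) x)
        \<le> C * inverse (real n * t powr (1 - \<alpha>)) * norm y \<and>
      norm (blinfun_apply (T t) x - blinfun_apply (euler_approx A n t) x)
        \<le> C * inverse (real n * t powr (- \<alpha>)) * norm y)"
proof -
  obtain M M1 where "analytic_semigroup T M M1"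
    using bounded_analytic_estimates[OF assms(1)] by blast
  then interpret analytic_semigroup T M M1 .
  have A: "A = local.A" unfolding assms(2) A_def ..
  obtain B where B: "B > 0" "\<And>a. a \<in> {0..2} \<Longrightarrow> \<bar>rGamma a\<bar> \<le> (B::real)"
    using rGamma_bounded by blast
  \<comment> \<open>The largest endpoint constant: 64 for Yosida and Dunford-Segal, 32 for
    Euler.\<close>
  define K where "K = 64 * M\<^sup>2 * M1\<^sup>2"
  define C where "C = (6 * M * B + 1) * K"
  have MM: "M > 0" "M1 > 0" using M M1 by auto
  have K: "K > 0" using MM by (simp add: K_def)
  have C: "C > 0" using MM B(1) K unfolding C_def by (intro mult_pos_pos add_nonneg_pos) auto
  show ?thesis
  proof (intro exI[of _ C] conjI C ballI allI impI)
    fix \<alpha> t :: real and n :: nat and x y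
    assume \<alpha>: "\<alpha> \<in> {0..1}" and t: "0 < t" and n: "1 \<le> n" and xy: "(x, y) \<in> frac_power A \<alpha>"
    have bound: "norm (T t x - V x) \<le> (6 * M * B + 1) * b * t powr (\<alpha> - 1) * norm y"
      if "\<And>x G. endpoint_bound t x G \<Longrightarrow> norm (T t x - V x) \<le> b * G" "b \<ge> 0" for V :: "'a \<Rightarrow>\<^sub>L 'a" and b
    proof -
      have "norm ((T t - V) x) \<le> (6 * M * B + 1) * b * t powr (\<alpha> - 1) * norm y"
        by (rule interpolate[OF t that(2) _ _ _ _ B(2) xy[unfolded A]])
          (use \<alpha> B that in \<open>auto simp: blinfun.diff_left\<close>)
      then show ?thesis by (simp add: blinfun.diff_left)
    qed
    have rate: "C * inverse (real n * t powr (1 - \<alpha>)) = (6 * M * B + 1) * (K * (1 / real n)) * t powr (\<alpha> - 1)"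
      using powr_minus[of t "1 - \<alpha>"] by (simp add: C_def inverse_eq_divide divide_simps)
    \<comment> \<open>Euler's endpoint factor \<open>b\<close> has an extra \<open>t\<close>, which
      raises the power from \<alpha> - 1 to \<alpha>.\<close>
    have euler_rate: "C * inverse (real n * t powr (- \<alpha>)) = (6 * M * B + 1) * (K * (t / real n)) * t powr (\<alpha> - 1)"
      using powr_minus[of t "- \<alpha>"] powr_add[of t 1 "\<alpha> - 1"] t by (simp add: C_def inverse_eq_divide divide_simps)
    show "norm (T t x - yosida_approx A n t x) \<le> C * inverse (real n * t powr (1 - \<alpha>)) * norm y"
      unfolding rate
    proof (rule bound)
      show "norm (T t x - yosida_approx A n t x) \<le> K * (1 / real n) * G" if "endpoint_bound t x G" for x G
        using yosida_error[OF t n that] unfolding K_def A .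
    qed (use K in simp)
    show "norm (T t x - dunford_segal_approx T n t x) \<le> C * inverse (real n * t powr (1 - \<alpha>)) * norm y"
      unfolding rate
    proof (rule bound)
      show "norm (T t x - dunford_segal_approx T n t x) \<le> K * (1 / real n) * G" if "endpoint_bound t x G" for x G
        using dunford_segal_error[OF t n that] unfolding K_def .
    qed (use K in simp)
    show "norm (T t x - euler_approx A n t x) \<le> C * inverse (real n * t powr (- \<alpha>)) * norm y"
      unfolding euler_rate
    proof (rule bound)
      fix x G assume G: "endpoint_bound t x G"
      have "norm (T t x - euler_approx A n t x) \<le> 32 * M\<^sup>2 * M1\<^sup>2 * (t / real n) * G"
        using euler_error[OF t n G] unfolding A .
      also have "\<dots> \<le> K * (t / real n) * G"
        using endpoint_nonneg[OF t G] t unfolding K_def by (intro mult_right_mono) auto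
      finally show "norm (T t x - euler_approx A n t x) \<le> K * (t / real n) * G" .
    qed (use K t in simp)
  qed
qed

end
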